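(* Let $G$ be a locally compact unimodular amenable topological group and let $T : G \curvearrowright X$ be a continuous action of $G$ on a compact metrizable space $X$. Let $\mu \in \mathcal{M}_T(X)$ be a $T$-invariant Borel probability measure on $X$, and let $(F_k)_{k=1}^\infty$ be a Følner sequence for $G$. Consider the conditions: (1) $T : G \curvearrowright X$ is uniquely ergodic. (2) For every sequence $(C_k)_{k=1}^\infty$ of Borel-measurable subsets of $X$ of positive $\mu$-measure, the sequence $\left( \alpha_{C_k}\left( \operatorname{Avg}_{F_k} f\right)\right)_{k=1}^\infty$ converges to $\int f \, \mathrm{d}\mu$ for all $f \in C(X)$. (3) For every sequence $(U_k)_{k=1}^\infty$ of open subsets of $X$ of positive $\mu$-measure, the sequence $\left( \alpha_{U_k}\left( \operatorname{Avg}_{F_k} f\right)\right)_{k=1}^\infty$ converges to $\int f \, \mathrm{d}\mu$ for all $f \in C(X)$. (4) For every sequence $(U_k)_{k=1}^\infty$ of open subsets of $X$ of positive $\mu$-measure, the sequence $\left( \alpha_{U_k}\left( \operatorname{Avg}_{F_k} f\right)\right)_{k=1}^\infty$ converges to some complex number for all $f \in C(X)$. Then (1)$\Rightarrow$(2)$\Rightarrow$(3)$\Rightarrow$(4), and if $\mu$ is fully supported on $X$ (gives positive measure to every nonempty open set), then (4)$\Rightarrow$(1). Furthermore, if the action is not uniquely ergodic, $\mu$ is fully supported, and $(X,\mu)$ is atomless, then there exist a sequence $(U_k')_{k=1}^\infty$ of open subsets of $X$ of positive measure and a function $f \in C(X)$ such that $\left( \alpha_{U_k'}\left( \operatorname{Avg}_{F_k}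 f\right)\right)_{k=1}^\infty$ diverges and $\mu(U_k') \searrow 0$ (i.e. $\mu(U_k')$ is non-increasing in $k$ with limit $0$).
   Context: $\mathcal{M}_T(X)$ denotes the set of $T$-invariant Borel probability measures on $X$; the action is uniquely ergodic if $\mathcal{M}_T(X)$ has exactly one element. $m$ is a bi-invariant Haar measure on $G$. For a compact $K \subseteq G$ with $m(K)>0$ and $f \in C(X)$, $\operatorname{Avg}_K f(x) = \frac{1}{m(K)} \int_K f(T_g x) \, \mathrm{d}m(g)$, a continuous function on $X$. For a measurable $C \subseteq X$ with $\mu(C)>0$, $\alpha_C(h) = \frac{1}{\mu(C)} \int_C h \, \mathrm{d}\mu$. A sequence $(F_k)_{k=1}^\infty$ of compact subsets of $G$ is Følner if $m(F_k)>0$ for all $k$ and $\lim_{k} \frac{m(gF_k \,\Delta\, F_k)}{m(F_k)} = 0$ for every $g \in G$. The action convention is $T_{gh} = T_g T_h$. *)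

theory Defs
  imports "HOL-Probability.Probability"
begin

text \<open>
  The acting group is a type of class \<^class>\<open>topological_group_add\<close>. This class is not
  commutative: \<open>g + h\<close>, \<open>0\<close> and \<open>- g\<close> stand for the product \<open>gh\<close>, the identity
  and the inverse of an arbitrary topological group, and the order of summands matters throughout.
\<close>

definition left_haar_measure :: "'g::topological_group_add measure \<Rightarrow> bool" where
  "left_haar_measure m \<longleftrightarrow>
     sets m = sets borel \<and>
     emeasure m (space m) \<noteq> 0 \<and>
     (\<forall>K. compact K \<longrightarrow> emeasure m K < \<infinity>) \<and>
     (\<forall>A \<in> sets borel. emeasure m A = (INF U \<in> {U. open U \<and> A \<subseteq> U}. emeasure m U)) \<and>
     (\<forall>U. open U \<longrightarrow> emeasure m U = (SUP K \<in> {K. compact K \<and> K \<subseteq> U}. emeasure m K)) \<and>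
     (\<forall>g. distr m borel (\<lambda>x. g + x) = m)"

text \<open>A locally compact group is unimodular iff it carries a measure of the following kind.\<close>

definition bi_invariant_haar_measure :: "'g::topological_group_add measure \<Rightarrow> bool" where
  "bi_invariant_haar_measure m \<longleftrightarrow>
     left_haar_measure m \<and> (\<forall>g. distr m borel (\<lambda>x. x + g) = m)"

text \<open>
  Amenability: a left-invariant mean \<open>M\<close> on the bounded continuous real functions. The values of
  \<open>M\<close> on other functions are irrelevant.
\<close>

definition amenable :: "'g::topological_group_add itself \<Rightarrow> bool" where
  "amenable _ \<longleftrightarrow>
     (let CB = {f :: 'g \<Rightarrow> real. continuous_on UNIV f \<and> bounded (range f)} in
      \<exists>M :: ('g \<Rightarrow> real) \<Rightarrow> real.
        (\<forall>f\<in>CB. \<forall>h\<in>CB. M (\<lambda>x. f x + h x) = M f + M h) \<and>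
        (\<forall>f\<in>CB. \<forall>c. M (\<lambda>x. c * f x) = c * M f) \<and>
        (\<forall>f\<in>CB. (\<forall>x. 0 \<le> f x) \<longrightarrow> 0 \<le> M f) \<and>
        M (\<lambda>x. 1) = 1 \<and>
        (\<forall>f\<in>CB. \<forall>g. M (\<lambda>x. f (g + x)) = M f))"

definition folner_sequence :: "'g::topological_group_add measure \<Rightarrow> (nat \<Rightarrow> 'g set) \<Rightarrow> bool" where
  "folner_sequence m F \<longleftrightarrow>
     (\<forall>k. compact (F k) \<and> measure m (F k) > 0) \<and>
     (\<forall>g. (\<lambda>k. measure m (sym_diff ((\<lambda>x. g + x) ` F k) (F k)) / measure m (F k)) \<longlonglongrightarrow> 0)"

definition continuous_action ::
  "('g::topological_group_add \<Rightarrow> 'x::topological_space \<Rightarrow> 'x) \<Rightarrow> bool" where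
  "continuous_action T \<longleftrightarrow>
     (\<forall>x. T 0 x = x) \<and>
     (\<forall>g h x. T (g + h) x = T g (T h x)) \<and>
     continuous_on UNIV (\<lambda>(g, x). T g x)"

definition invariant_measures :: "('g \<Rightarrow> 'x::topological_space \<Rightarrow> 'x) \<Rightarrow> 'x measure set" where
  "invariant_measures T =
     {\<mu>. sets \<mu> = sets borel \<and> prob_space \<mu> \<and> (\<forall>g. distr \<mu> borel (T g) = \<mu>)}"

definition uniquely_ergodic :: "('g \<Rightarrow> 'x::topological_space \<Rightarrow> 'x) \<Rightarrow> bool" where
  "uniquely_ergodic T \<longleftrightarrow> (\<exists>!\<mu>. \<mu> \<in> invariant_measures T)"

definition Avg ::
  "'g measure \<Rightarrow> ('g \<Rightarrow> 'x \<Rightarrow> 'x) \<Rightarrow> 'g set \<Rightarrow> ('x \<Rightarrow> complex) \<Rightarrow> 'x \<Rightarrow> complex" where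
  "Avg m T K f x = (1 / measure m K) *\<^sub>R (LINT g:K|m. f (T g x))"

definition set_average :: "'x measure \<Rightarrow> 'x set \<Rightarrow> ('x \<Rightarrow> complex) \<Rightarrow> complex" where
  "set_average \<mu> C h = (1 / measure \<mu> C) *\<^sub>R (LINT x:C|\<mu>. h x)"

text \<open>
  Below, \<open>\<C>\<close> is the class of sets from which the terms of the sequence \<open>C\<close> are drawn:
  \<open>sets borel\<close> for Borel sets, \<open>Collect open\<close> for open sets.
\<close>

definition averages_converge_to_mean ::
  "'g measure \<Rightarrow> ('g \<Rightarrow> 'x::topological_space \<Rightarrow> 'x) \<Rightarrow> 'x measure \<Rightarrow> (nat \<Rightarrow> 'g set) \<Rightarrow>
     'x set set \<Rightarrow> bool" where
  "averages_converge_to_mean m T \<mu> F \<C> \<longleftrightarrow>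
     (\<forall>C :: nat \<Rightarrow> 'x set. (\<forall>k. C k \<in> \<C> \<and> measure \<mu> (C k) > 0) \<longrightarrow>
       (\<forall>f :: 'x \<Rightarrow> complex. continuous_on UNIV f \<longrightarrow>
         (\<lambda>k. set_average \<mu> (C k) (Avg m T (F k) f)) \<longlonglongrightarrow> (LINT x|\<mu>. f x)))"

definition averages_converge ::
  "'g measure \<Rightarrow> ('g \<Rightarrow> 'x::topological_space \<Rightarrow> 'x) \<Rightarrow> 'x measure \<Rightarrow> (nat \<Rightarrow> 'g set) \<Rightarrow>
     'x set set \<Rightarrow> bool" where
  "averages_converge m T \<mu> F \<C> \<longleftrightarrow>
     (\<forall>C :: nat \<Rightarrow> 'x set. (\<forall>k. C k \<in> \<C> \<and> measure \<mu> (C k) > 0) \<longrightarrow>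
       (\<forall>f :: 'x \<Rightarrow> complex. continuous_on UNIV f \<longrightarrow>
         convergent (\<lambda>k. set_average \<mu> (C k) (Avg m T (F k) f))))"

definition fully_supported :: "'x::topological_space measure \<Rightarrow> bool" where
  "fully_supported \<mu> \<longleftrightarrow> (\<forall>U. open U \<and> U \<noteq> {} \<longrightarrow> measure \<mu> U > 0)"

definition atomless :: "'x measure \<Rightarrow> bool" where
  "atomless \<mu> \<longleftrightarrow>
     \<not> (\<exists>A \<in> sets \<mu>. emeasure \<mu> A > 0 \<and>
          (\<forall>B \<in> sets \<mu>. B \<subseteq> A \<longrightarrow> emeasure \<mu> B = 0 \<or> emeasure \<mu> (A - B) = 0))"

end

theory Submission
  imports Defs
begin

text \<open>
  If \<open>T\<close> is uniquely ergodic, the Folner averages of a continuous \<open>f\<close> converge uniformly to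
  \<open>\<integral> f d\<mu>\<close>: otherwise there are points \<open>x\<^sub>k\<close> at which they stay away from that value, and a
  pointwise cluster point of the functionals \<open>f \<mapsto> Avg\<^bsub>F k\<^esub> f x\<^sub>k\<close> is, by the Folner property and
  the Riesz representation theorem, integration against a second invariant measure. Uniform
  convergence is inherited by averages over arbitrary sets.

  Conversely, let two invariant measures give different integrals to a continuous real \<open>f\<close>. As
  averaging along the orbit preserves these integrals, for suitable \<open>a < b\<close> all the open sets
  \<open>{x. Avg\<^bsub>F k\<^esub> f x > b}\<close> and \<open>{x. Avg\<^bsub>F k\<^esub> f x < a}\<close> are nonempty. Choosing \<open>U\<^sub>k\<close> inside the
  former for even \<open>k\<close> and inside the latter for odd \<open>k\<close> yields divergence; if \<open>\<mu>\<close> is atomless,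
  the \<open>U\<^sub>k\<close> can be shrunk around a point.
\<close>

section \<open>The Riesz representation theorem on compact metrizable spaces\<close>

text \<open>The function is the distance to the complement of \<open>U\<close>, truncated at 1. The
  type carries only a topology, so a compatible metric is first obtained from metrizability.\<close>

lemma metrizable_open_eq_positive_set:
  fixes U :: "'x::topological_space set"
  assumes "metrizable_space (euclidean :: 'x topology)" "open U"
  obtains \<phi> :: "'x \<Rightarrow> real" where "continuous_on UNIV \<phi>" "\<And>x. 0 \<le> \<phi> x" "\<And>x. \<phi> x \<le> 1" "U = {x. \<phi> x > 0}"
proof (cases "U = UNIV")
  case True
  then show ?thesis by (intro that[of "\<lambda>_. 1"]) auto
next
  case False
  obtain M d where Md: "Metric_space M d" and eu: "(euclidean :: 'x topology) = Metric_space.mtopology M d"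
    using assms(1) unfolding metrizable_space_def by blast
  interpret Metric_space M d by fact
  have M: "M = UNIV" using eu by (metis topspace_mtopology topspace_euclidean)
  have opens: "open S \<longleftrightarrow> (\<forall>x\<in>S. \<exists>r>0. mball x r \<subseteq> S)" for S
    using openin_mtopology[of S] unfolding eu[symmetric] by (auto simp: M)
  \<comment> \<open>The infimum needs a nonempty complement, which is why \<open>U = UNIV\<close>
    was treated separately.\<close>
  define \<psi> where "\<psi> x = (INF y\<in>-U. d x y)" for x
  have bdd: "bdd_below (d x ` (-U))" for x by (auto intro!: bdd_belowI[of _ 0])
  have \<psi>0: "0 \<le> \<psi> x" for x unfolding \<psi>_def using False by (intro cINF_greatest) auto
  \<comment> \<open>The distance to a set is 1-Lipschitz; its continuity follows from this.\<close>
  have lip: "\<psi> x \<le> d x z + \<psi> z" for x z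
  proof -
    have "\<psi> x - d x z \<le> d z y" if "y \<in> -U" for y
      using cINF_lower[OF bdd that, of x] triangle[of x z y] by (auto simp: M \<psi>_def)
    then have "\<psi> x - d x z \<le> \<psi> z" unfolding \<psi>_def[of z] using False by (intro cINF_greatest) auto
    then show ?thesis by simp
  qed
  have cont: "continuous_on UNIV \<psi>"
  proof (subst continuous_on_open_vimage)
    show "\<forall>B. open B \<longrightarrow> open (\<psi> -` B \<inter> UNIV)"
    proof (intro allI impI)
      fix B :: "real set" assume "open B"
      show "open (\<psi> -` B \<inter> UNIV)" unfolding opens
      proof
        fix x assume "x \<in> \<psi> -` B \<inter> UNIV"
        then obtain r where r: "r > 0" "ball (\<psi> x) r \<subseteq> B" using \<open>open B\<close> by (auto simp: open_contains_ball)
        have "\<psi> z \<in> ball (\<psi> x) r" if "z \<in> mball x r" for z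
          using that lip[of x z] lip[of z x] commute[of x z] by (auto simp: dist_real_def)
        then show "\<exists>r>0. mball x r \<subseteq> \<psi> -` B \<inter> UNIV" using r by blast
      qed
    qed
  qed simp
  have pos: "\<psi> x > 0 \<longleftrightarrow> x \<in> U" for x
  proof
    assume "x \<in> U"
    then obtain r where r: "r > 0" "mball x r \<subseteq> U" using assms(2) opens by blast
    have "r \<le> d x y" if "y \<notin> U" for y
      using that r(2) in_mball[of y x r] M by (metis UNIV_I leI subsetD)
    then have "r \<le> \<psi> x" unfolding \<psi>_def using False by (intro cINF_greatest) auto
    with r show "\<psi> x > 0" by simp
  next
    assume "\<psi> x > 0"
    then show "x \<in> U" using cINF_lower[OF bdd, of x x] by (auto simp: \<psi>_def M)
  qed
  show ?thesis
  proof (rule that[of "\<lambda>x. min 1 (\<psi> x)"])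
    show "continuous_on UNIV (\<lambda>x. min 1 (\<psi> x))" by (intro continuous_intros cont)
  qed (use \<psi>0 pos in auto)
qed

text \<open>With \<open>\<phi>\<close> positive exactly on \<open>U\<close>, the functions
  \<open>min 1 (n * \<phi> x)\<close> increase to the indicator of \<open>U\<close>. At each point
  of \<open>U\<close> the value 1 is actually attained from some \<open>n\<close> on, which suits
  both dominated convergence and a compactness argument.\<close>

lemma open_approx_by_continuous:
  fixes U :: "'x::topological_space set"
  assumes "metrizable_space (euclidean :: 'x topology)" "open U"
  obtains a :: "nat \<Rightarrow> 'x \<Rightarrow> real" where "\<And>n. continuous_on UNIV (a n)" "\<And>n x. 0 \<le> a n x"
    "\<And>n x. a n x \<le> indicator U x" "\<And>x m n. m \<le> n \<Longrightarrow> a m x \<le> a n x"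
    "\<And>x. x \<in> U \<Longrightarrow> \<forall>\<^sub>F n in sequentially. a n x = 1"
proof -
  obtain \<phi> :: "'x \<Rightarrow> real" where \<phi>: "continuous_on UNIV \<phi>" "\<And>x. 0 \<le> \<phi> x" "\<And>x. \<phi> x \<le> 1" "U = {x. \<phi> x > 0}"
    using metrizable_open_eq_positive_set[OF assms] by blast
  show ?thesis
  proof (rule that[of "\<lambda>n x. min 1 (real n * \<phi> x)"])
    show "continuous_on UNIV (\<lambda>x. min 1 (real n * \<phi> x))" for n by (intro continuous_intros \<phi>(1))
    show "0 \<le> min 1 (real n * \<phi> x)" for n x using \<phi>(2)[of x] by simp
    show "min 1 (real n * \<phi> x) \<le> indicator U x" for n x
      using \<phi>(2)[of x] by (cases "\<phi> x = 0") (auto simp: \<phi>(4) indicator_def)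
    show "min 1 (real m * \<phi> x) \<le> min 1 (real n * \<phi> x)" if "m \<le> n" for x m n
      using mult_right_mono[of "real m" "real n" "\<phi> x"] that \<phi>(2)[of x] by auto
    show "\<forall>\<^sub>F n in sequentially. min 1 (real n * \<phi> x) = 1" if "x \<in> U" for x
    proof -
      have p: "\<phi> x > 0" using that \<phi>(4) by simp
      obtain N :: nat where N: "1 / \<phi> x \<le> real N" using real_arch_simple by blast
      show ?thesis
      proof (rule eventually_sequentiallyI[of N])
        fix n assume "N \<le> n"
        then have "1 / \<phi> x \<le> real n" using N by linarith
        then show "min 1 (real n * \<phi> x) = 1" using p by (simp add: divide_le_eq min_def)
      qed
    qed
  qed
qed

text \<open>The open sets on which \<open>f < h n\<close> cover the compact space. A finite subcover
  suffices, and by monotonicity its largest index works at every point.\<close>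

lemma Dini_strict:
  fixes f :: "'x::topological_space \<Rightarrow> real" and h :: "nat \<Rightarrow> 'x \<Rightarrow> real"
  assumes "compact (UNIV :: 'x set)" "continuous_on UNIV f" "\<And>n. continuous_on UNIV (h n)"
    and mono: "\<And>m n x. m \<le> n \<Longrightarrow> h m x \<le> h n x" and "\<And>x. \<exists>n. f x < h n x"
  obtains n where "\<And>x. f x < h n x"
proof -
  have op: "open {x. f x < h n x}" for n by (intro open_Collect_less assms)
  have "UNIV \<subseteq> (\<Union>n\<in>UNIV. {x. f x < h n x})" using assms(5) by auto
  then obtain D where D: "finite D" "UNIV \<subseteq> (\<Union>n\<in>D. {x. f x < h n x})"
    using compactE_image[OF assms(1), of UNIV "\<lambda>n. {x. f x < h n x}"] op by metis
  show ?thesis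
  proof (rule that[of "Max D"])
    fix x
    obtain n where "n \<in> D" "f x < h n x" using D(2) by auto
    then show "f x < h (Max D) x" using mono[of n "Max D" x] D(1) by auto
  qed
qed

text \<open>Dominated convergence along continuous approximations of the indicator carries equality
  of integrals over to open sets, which form an intersection-stable generator of the Borel
  sets.\<close>

lemma finite_borel_measure_eqI:
  fixes M N :: "'x::topological_space measure"
  assumes metr: "metrizable_space (euclidean :: 'x topology)"
    and "finite_measure M" "finite_measure N" and sets: "sets M = sets borel" "sets N = sets borel"
    and eq: "\<And>f :: 'x \<Rightarrow> real. continuous_on UNIV f \<Longrightarrow> (\<And>x. 0 \<le> f x \<and> f x \<le> 1) \<Longrightarrow> (LINT x|M. f x) = (LINT x|N. f x)"
  shows "M = N"
proof -
  interpret M: finite_measure M by fact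
  interpret N: finite_measure N by fact
  have eqU: "emeasure M U = emeasure N U" if U: "open U" for U
  proof -
    obtain a :: "nat \<Rightarrow> 'x \<Rightarrow> real" where a: "\<And>n. continuous_on UNIV (a n)" "\<And>n x. 0 \<le> a n x"
      "\<And>n x. a n x \<le> indicator U x" "\<And>x m n. m \<le> n \<Longrightarrow> a m x \<le> a n x"
      "\<And>x. x \<in> U \<Longrightarrow> \<forall>\<^sub>F n in sequentially. a n x = 1"
      using open_approx_by_continuous[OF metr U] by metis
    have a1: "a n x \<le> 1" for n x by (rule order_trans[OF a(3)]) (simp add: indicator_def)
    have lim: "(\<lambda>n. a n x) \<longlonglongrightarrow> indicator U x" for x
    proof (cases "x \<in> U")
      case True
      then show ?thesis by (auto intro!: tendsto_eventually a(5))
    next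
      case False
      then have "a n x = 0" for n using a(2)[of n x] a(3)[of n x] by simp
      then show ?thesis using False by simp
    qed
    have conv: "(\<lambda>n. LINT x|P. a n x) \<longlonglongrightarrow> measure P U" if "finite_measure P" "sets P = sets borel" for P
    proof -
      interpret finite_measure P by fact
      have mb: "a n \<in> borel_measurable P" for n
        using borel_measurable_continuous_onI[OF a(1)[of n]] that(2) measurable_cong_sets by blast
      have "U \<in> sets P" using U that by simp
      have "(\<lambda>n. LINT x|P. a n x) \<longlonglongrightarrow> (LINT x|P. indicator U x)"
        by (rule integral_dominated_convergence[where w="\<lambda>_. 1"])
           (use mb lim a(2) a1 \<open>U \<in> sets P\<close> in auto)
      then show ?thesis using \<open>U \<in> sets P\<close> sets.sets_into_space[OF \<open>U \<in> sets P\<close>] by (simp add: Int_absorb2)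
    qed
    have "measure M U = measure N U"
    proof (rule LIMSEQ_unique[OF conv[OF assms(2) sets(1)]])
      show "(\<lambda>n. LINT x|M. a n x) \<longlonglongrightarrow> measure N U"
        using conv[OF assms(3) sets(2)] eq[OF a(1)] a(2) a1 by simp
    qed
    then show ?thesis by (simp add: M.emeasure_eq_measure N.emeasure_eq_measure)
  qed
  show ?thesis
  proof (rule measure_eqI_generator_eq[where E="{U. open U}" and \<Omega>=UNIV and A="\<lambda>_. UNIV"])
    show "Int_stable {U::'x set. open U}" by (auto simp: Int_stable_def)
    show "sets M = sigma_sets UNIV {U. open U}" "sets N = sigma_sets UNIV {U. open U}"
      using sets by (simp_all add: borel_def)
  qed (use eqU in auto)
qed

section \<open>Content and outer measure of a positive functional\<close>

text \<open>Members have to vanish off \<open>U\<close>, but their closed support may leave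
  \<open>U\<close>. This makes functions such as \<open>max 0 (f - e)\<close> easy to place below an
  open set.\<close>

definition functions_below :: "'x::topological_space set \<Rightarrow> ('x \<Rightarrow> real) set" where
  "functions_below U = {f. continuous_on UNIV f \<and> (\<forall>x. 0 \<le> f x \<and> f x \<le> indicator U x)}"

lemma functions_below_mono:
  assumes "U \<subseteq> V" shows "functions_below U \<subseteq> functions_below V"
proof -
  have "indicator U x \<le> (indicator V x :: real)" for x using assms by (auto simp: indicator_def)
  then show ?thesis unfolding functions_below_def by (blast intro: order_trans)
qed

lemma functions_below_le_1:
  assumes "f \<in> functions_below U" shows "f x \<le> 1"
proof -
  have "f x \<le> indicator U x" using assms by (simp add: functions_below_def)
  also have "\<dots> \<le> 1" by (simp add: indicator_def)
  finally show ?thesis .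
qed

text \<open>\<open>L\<close> is a total function, but only its values on continuous functions are
  constrained. The normalisation makes the representing measure a probability measure.\<close>

locale positive_functional =
  fixes L :: "('x::topological_space \<Rightarrow> real) \<Rightarrow> real"
  assumes compact: "compact (UNIV :: 'x set)"
    and metrizable: "metrizable_space (euclidean :: 'x topology)"
    and add: "\<And>f g. continuous_on UNIV f \<Longrightarrow> continuous_on UNIV g \<Longrightarrow> L (\<lambda>x. f x + g x) = L f + L g"
    and scale: "\<And>f c. continuous_on UNIV f \<Longrightarrow> L (\<lambda>x. c * f x) = c * L f"
    and nonneg: "\<And>f. continuous_on UNIV f \<Longrightarrow> (\<And>x. 0 \<le> f x) \<Longrightarrow> 0 \<le> L f"
    and one: "L (\<lambda>_. 1) = 1"
begin

lemma const: "L (\<lambda>_. c) = c"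
  using scale[of "\<lambda>_. 1" c] one by simp

lemma mono:
  assumes "continuous_on UNIV f" "continuous_on UNIV g" "\<And>x. f x \<le> g x"
  shows "L f \<le> L g"
proof -
  have "0 \<le> L (\<lambda>x. g x + (-1) * f x)"
    by (intro nonneg continuous_intros assms) (use assms(3) in auto)
  also have "\<dots> = L g + (-1) * L f"
    by (subst add) (intro continuous_intros assms | subst scale | rule refl)+
  finally show ?thesis by simp
qed

lemma sum:
  assumes "finite I" "\<And>i. i \<in> I \<Longrightarrow> continuous_on UNIV (f i)"
  shows "L (\<lambda>x. \<Sum>i\<in>I. f i x) = (\<Sum>i\<in>I. L (f i))"
  using assms
proof (induction I rule: finite_induct)
  case empty
  then show ?case using const[of 0] by simp
next
  case (insert i I)
  then show ?case using add[of "f i" "\<lambda>x. \<Sum>i\<in>I. f i x"] by (simp add: continuous_on_sum)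
qed

text \<open>This is the value that the representing measure must take on open sets;
  \<open>outer\<close> then extends it to all sets by outer regularity.\<close>

definition open_content :: "'x set \<Rightarrow> ennreal" where
  "open_content U = (SUP f\<in>functions_below U. ennreal (L f))"

definition outer :: "'x set \<Rightarrow> ennreal" where
  "outer A = (INF U\<in>{U. open U \<and> A \<subseteq> U}. open_content U)"

lemma open_content_mono: "U \<subseteq> V \<Longrightarrow> open_content U \<le> open_content V"
  unfolding open_content_def by (rule SUP_subset_mono[OF functions_below_mono order_refl])

lemma zero_below: "(\<lambda>_. 0) \<in> functions_below U"
  by (auto simp: functions_below_def)

lemma open_content_le_1: "open_content U \<le> 1"
proof -
  have "L f \<le> 1" if "f \<in> functions_below U" for f
  proof -
    have "f x \<le> 1" for x using that by (rule functions_below_le_1)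
    then show ?thesis using mono[of f "\<lambda>_. 1"] that one by (auto simp: functions_below_def)
  qed
  then show ?thesis unfolding open_content_def by (auto intro!: SUP_least simp flip: ennreal_1 intro: ennreal_leI)
qed

lemma outer_open: "open U \<Longrightarrow> outer U = open_content U"
  unfolding outer_def by (rule antisym) (auto intro!: INF_lower INF_greatest open_content_mono)

lemma outer_mono: "A \<subseteq> B \<Longrightarrow> outer A \<le> outer B"
  unfolding outer_def by (intro INF_superset_mono) auto

text \<open>A test function below the union is dominated, up to \<open>e\<close>, by a finite sum of
  test functions below the single \<open>U i\<close>; compactness enters through
  \<open>Dini_strict\<close>.\<close>

lemma open_content_Union_le:
  fixes U :: "nat \<Rightarrow> 'x set"
  assumes "\<And>i. open (U i)"
  shows "open_content (\<Union>i. U i) \<le> (\<Sum>i. open_content (U i))"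
  unfolding open_content_def[of "\<Union>i. U i"]
proof (rule SUP_least)
  fix f assume f: "f \<in> functions_below (\<Union>i. U i)"
  have "\<exists>a :: nat \<Rightarrow> 'x \<Rightarrow> real. (\<forall>n. continuous_on UNIV (a n)) \<and> (\<forall>n x. 0 \<le> a n x) \<and>
    (\<forall>n x. a n x \<le> indicator (U i) x) \<and> (\<forall>x m n. m \<le> n \<longrightarrow> a m x \<le> a n x) \<and>
    (\<forall>x\<in>U i. \<forall>\<^sub>F n in sequentially. a n x = 1)" for i
    using open_approx_by_continuous[OF metrizable assms, of i] by (smt (verit))
  then obtain a :: "nat \<Rightarrow> nat \<Rightarrow> 'x \<Rightarrow> real" where a: "\<And>i n. continuous_on UNIV (a i n)"
    "\<And>i n x. 0 \<le> a i n x" "\<And>i n x. a i n x \<le> indicator (U i) x" "\<And>i x m n. m \<le> n \<Longrightarrow> a i m x \<le> a i n x"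
    "\<And>i x. x \<in> U i \<Longrightarrow> \<forall>\<^sub>F n in sequentially. a i n x = 1"
    by metis
  have below: "a i n \<in> functions_below (U i)" for i n unfolding functions_below_def using a(1-3) by blast
  show "ennreal (L f) \<le> (\<Sum>i. open_content (U i))"
  proof (rule ennreal_le_epsilon)
    fix e :: real assume e: "e > 0"
    have cf: "continuous_on UNIV f" using f by (simp add: functions_below_def)
    \<comment> \<open>The same \<open>n\<close> bounds the number of summands and selects the
      approximation level, so a single monotone sequence is available for
      \<open>Dini_strict\<close>.\<close>
    have mono_h: "(\<Sum>i<m. a i m x) + e \<le> (\<Sum>i<n. a i n x) + e" if "m \<le> n" for m n x
    proof -
      have "(\<Sum>i<m. a i m x) \<le> (\<Sum>i<m. a i n x)" using that by (intro sum_mono a(4))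
      also have "\<dots> \<le> (\<Sum>i<n. a i n x)" using that a(2) by (intro sum_mono2) auto
      finally show ?thesis by simp
    qed
    have reach: "\<exists>n. f x < (\<Sum>i<n. a i n x) + e" for x
    proof (cases "x \<in> (\<Union>i. U i)")
      case True
      then obtain j where j: "x \<in> U j" by blast
      then have "\<forall>\<^sub>F n in sequentially. a j n x = 1 \<and> n > j"
        by (intro eventually_conj a(5) eventually_gt_at_top)
      then obtain n where n: "a j n x = 1" "n > j" by (auto simp: eventually_sequentially)
      have "f x \<le> 1" using f by (rule functions_below_le_1)
      also have "1 = (\<Sum>i\<in>{j}. a i n x)" using n by simp
      also have "\<dots> \<le> (\<Sum>i<n. a i n x)" using n a(2) by (intro sum_mono2) auto
      finally show ?thesis using e by (intro exI[of _ n]) simp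
    next
      case False
      \<comment> \<open>Off the union \<open>f\<close> vanishes, so the empty sum at
        \<open>n = 0\<close> already suffices because of the summand \<open>e\<close>.\<close>
      then have "f x \<le> 0" using f by (auto simp: functions_below_def split: if_splits dest!: spec[of _ x])
      then show ?thesis using e by (intro exI[of _ 0]) simp
    qed
    obtain n where n: "\<And>x. f x < (\<Sum>i<n. a i n x) + e"
      by (rule Dini_strict[OF compact cf _ mono_h reach]) (auto intro!: continuous_intros a(1))
    have "L f \<le> L (\<lambda>x. (\<Sum>i<n. a i n x) + e)"
      by (rule mono) (auto intro!: continuous_intros a(1) cf less_imp_le[OF n])
    also have "\<dots> = (\<Sum>i<n. L (a i n)) + e"
      by (simp add: add const sum a(1) continuous_on_sum)
    finally have "ennreal (L f) \<le> ennreal ((\<Sum>i<n. L (a i n)) + e)" by (rule ennreal_leI)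
    also have "\<dots> = (\<Sum>i<n. ennreal (L (a i n))) + ennreal e"
      using e by (simp add: ennreal_plus sum_nonneg nonneg a(1,2) sum_ennreal)
    also have "\<dots> \<le> (\<Sum>i<n. open_content (U i)) + ennreal e"
      unfolding open_content_def by (intro add_mono sum_mono SUP_upper below order_refl)
    also have "\<dots> \<le> (\<Sum>i. open_content (U i)) + ennreal e"
      by (intro add_right_mono sum_le_suminf) auto
    finally show "ennreal (L f) \<le> (\<Sum>i. open_content (U i)) + ennreal e" .
  qed
qed

lemma outer_less_iff: "outer A < c \<longleftrightarrow> (\<exists>U. open U \<and> A \<subseteq> U \<and> open_content U < c)"
  unfolding outer_def by (auto simp: INF_less_iff)

text \<open>The outer measure is bounded by 1, hence finite, so adding a positive \<open>e\<close>
  makes it strictly larger and the defining infimum can be undercut.\<close>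

lemma outer_approx:
  assumes "e > 0" obtains U where "open U" "A \<subseteq> U" "open_content U \<le> outer A + ennreal e"
proof -
  have "outer A \<le> open_content UNIV" unfolding outer_def by (rule INF_lower) auto
  also have "\<dots> \<le> 1" by (rule open_content_le_1)
  finally have "outer A < \<top>" by (simp add: le_less_trans)
  then obtain r where "outer A = ennreal r" "r \<ge> 0" by (cases "outer A") auto
  then have "outer A < outer A + ennreal e" using assms by (simp add: ennreal_less_iff flip: ennreal_plus)
  then obtain U where "open U" "A \<subseteq> U" "open_content U < outer A + ennreal e"
    unfolding outer_less_iff by blast
  then show ?thesis using that less_imp_le by metis
qed

lemma outer_space: "outer_measure_space UNIV outer"
  unfolding outer_measure_space_def
proof (intro conjI)
  have "open_content {} = 0" 
  proof -
    have "L f = 0" if "f \<in> functions_below {}" for f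
    proof -
      have "f = (\<lambda>_. 0)" using that by (auto simp: functions_below_def intro!: ext antisym)
      then show ?thesis using const[of 0] by simp
    qed
    then show ?thesis unfolding open_content_def using zero_below by (auto intro!: antisym SUP_least)
  qed
  then show "positive UNIV outer" by (simp add: positive_def outer_open)
  show "increasing UNIV outer" by (simp add: increasing_def outer_mono)
  show "countably_subadditive UNIV outer"
    unfolding countably_subadditive_def
  proof (intro allI impI)
    fix A :: "nat \<Rightarrow> 'x set"
    show "outer (\<Union>i. A i) \<le> (\<Sum>i. outer (A i))"
    proof (rule ennreal_le_epsilon)
      fix e :: real assume e: "e > 0"
      \<comment> \<open>The i-th set is covered with excess \<open>e * (1/2)^(i+1)\<close>. These
        excesses sum to \<open>e\<close>, and subadditivity is thereby reduced to open sets.\<close>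
      have "\<exists>U. open U \<and> A i \<subseteq> U \<and> open_content U \<le> outer (A i) + ennreal (e * (1/2)^Suc i)" for i
        using outer_approx[of "e * (1/2)^Suc i" "A i"] e by (metis mult_pos_pos zero_less_power half_gt_zero zero_less_one)
      then obtain U where U: "\<And>i. open (U i)" "\<And>i. A i \<subseteq> U i"
         "\<And>i. open_content (U i) \<le> outer (A i) + ennreal (e * (1/2)^Suc i)" by metis
      have "outer (\<Union>i. A i) \<le> outer (\<Union>i. U i)" using U(2) by (intro outer_mono) blast
      also have "\<dots> = open_content (\<Union>i. U i)" by (intro outer_open open_UN) (use U in auto)
      also have "\<dots> \<le> (\<Sum>i. open_content (U i))" by (rule open_content_Union_le[OF U(1)])
      also have "\<dots> \<le> (\<Sum>i. outer (A i) + ennreal (e * (1/2)^Suc i))" by (intro suminf_le U(3)) auto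
      also have "\<dots> = (\<Sum>i. outer (A i)) + (\<Sum>i. ennreal (e * (1/2)^Suc i))" by (rule suminf_add[symmetric]) auto
      also have "(\<Sum>i. ennreal (e * (1/2)^Suc i)) = ennreal e"
        using e sums_mult[OF power_half_series, of e] by (intro suminf_ennreal_eq) auto
      finally show "outer (\<Union>i. A i) \<le> (\<Sum>i. outer (A i)) + ennreal e" .
    qed
  qed
qed

text \<open>This is the hard half of the Caratheodory condition for \<open>U\<close>, tested on an
  open set \<open>V\<close>. A test function \<open>f\<close> below \<open>V \<inter> U\<close> and
  a test function \<open>g\<close> below a neighbourhood of \<open>V - U\<close> are combined into
  one below \<open>V\<close>, at a loss of \<open>e\<close>.\<close>

lemma outer_split_open:
  assumes U: "open U" and V: "open V"
  shows "open_content (V \<inter> U) + outer (V - U) \<le> open_content V"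
proof -
  have "ennreal (L f) + outer (V - U) \<le> open_content V" if f: "f \<in> functions_below (V \<inter> U)" for f
  proof (rule ennreal_le_epsilon)
    fix e :: real assume e: "e > 0"
    have cf: "continuous_on UNIV f" and f0: "\<And>x. 0 \<le> f x" and f1: "\<And>x. f x \<le> indicator (V \<inter> U) x"
      using f unfolding functions_below_def by blast+
    \<comment> \<open>As \<open>f\<close> vanishes off \<open>U\<close>, this is an open set
      containing \<open>V - U\<close> on which \<open>f\<close> is still small.\<close>
    define W where "W = V \<inter> {x. f x < e}"
    have W: "open W" unfolding W_def using V cf by (intro open_Int open_Collect_less) auto
    have "f x \<le> 0" if "x \<notin> U" for x using f1[of x] that by simp
    then have "V - U \<subseteq> W" using e by (force simp: W_def)
    then have "outer (V - U) \<le> open_content W" using outer_open[OF W] outer_mono by metis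
    moreover have "ennreal (L f) + open_content W \<le> open_content V + ennreal e"
      unfolding open_content_def[of W]
    proof (subst ennreal_SUP_add_right)
      show "(SUP g\<in>functions_below W. ennreal (L f) + ennreal (L g)) \<le> open_content V + ennreal e"
      proof (rule SUP_least)
        fix g assume g: "g \<in> functions_below W"
        have cg: "continuous_on UNIV g" and g0: "\<And>x. 0 \<le> g x" and g1: "\<And>x. g x \<le> indicator W x"
          using g unfolding functions_below_def by blast+
        \<comment> \<open>On \<open>W\<close> one has \<open>f < e\<close>, so
          \<open>h \<le> g \<le> 1\<close>; on the rest of \<open>V\<close>, \<open>g = 0\<close>
          and \<open>h \<le> f \<le> 1\<close>; off \<open>V\<close> both functions vanish. Hence
          \<open>h\<close> is again below \<open>V\<close>.\<close>
        define h where "h x = max 0 (f x + g x - e)" for x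
        have ch: "continuous_on UNIV h" unfolding h_def by (intro continuous_intros cf cg)
        have "h x \<le> indicator V x" for x
          using f0[of x] f1[of x] g0[of x] g1[of x] e
          by (cases "x \<in> V"; cases "x \<in> W"; cases "x \<in> U") (auto simp: h_def W_def)
        then have h: "h \<in> functions_below V" using ch by (auto simp: functions_below_def h_def)
        have "L f + L g \<le> L (\<lambda>x. h x + e)"
          unfolding add[OF cf cg, symmetric]
          by (rule mono) (auto intro!: continuous_intros cf cg ch simp: h_def)
        also have "\<dots> = L h + e" by (simp add: add ch const)
        finally have "ennreal (L f + L g) \<le> ennreal (L h + e)" by (rule ennreal_leI)
        then have "ennreal (L f) + ennreal (L g) \<le> ennreal (L h) + ennreal e"
          using nonneg[OF cf f0] nonneg[OF cg g0] nonneg[OF ch] e by (simp add: ennreal_plus h_def)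
        also have "\<dots> \<le> open_content V + ennreal e" unfolding open_content_def by (intro add_right_mono SUP_upper h)
        finally show "ennreal (L f) + ennreal (L g) \<le> open_content V + ennreal e" .
      qed
    qed (use zero_below in auto)
    ultimately show "ennreal (L f) + outer (V - U) \<le> open_content V + ennreal e"
      by (meson add_left_mono order_trans)
  qed
  then have "(SUP f\<in>functions_below (V \<inter> U). ennreal (L f) + outer (V - U)) \<le> open_content V"
    by (rule SUP_least)
  then show ?thesis
    unfolding open_content_def[of "V \<inter> U"] by (subst ennreal_SUP_add_left[symmetric]) (use zero_below in auto)
qed

text \<open>An arbitrary \<open>A\<close> is enclosed in an open \<open>V\<close> of almost the same
  outer measure, to which \<open>outer_split_open\<close> applies. The reverse inequality is
  subadditivity.\<close>

lemma open_in_lambda_system: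
  assumes U: "open U" shows "U \<in> lambda_system UNIV UNIV outer"
  unfolding lambda_system_def
proof (intro CollectI conjI ballI UNIV_I, unfold Compl_eq_Diff_UNIV[symmetric], rule antisym)
  fix A
  show "outer (U \<inter> A) + outer (- U \<inter> A) \<le> outer A"
  proof (rule ennreal_le_epsilon)
    fix e :: real assume "e > 0"
    then obtain V where V: "open V" "A \<subseteq> V" "open_content V \<le> outer A + ennreal e" using outer_approx by blast
    have "outer (U \<inter> A) \<le> outer (V \<inter> U)" "outer (- U \<inter> A) \<le> outer (V - U)" using V by (auto intro!: outer_mono)
    then have "outer (U \<inter> A) + outer (- U \<inter> A) \<le> open_content (V \<inter> U) + outer (V - U)"
      using outer_open[of "V \<inter> U"] U V by (simp add: add_mono open_Int)
    also have "\<dots> \<le> open_content V" by (rule outer_split_open[OF U V(1)])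
    finally show "outer (U \<inter> A) + outer (- U \<inter> A) \<le> outer A + ennreal e" using V(3) by order
  qed
  have "countably_subadditive (Pow UNIV) outer" "positive (Pow UNIV) outer"
    using outer_space by (simp_all add: outer_measure_space_def)
  moreover have "ring_of_sets UNIV (Pow UNIV :: 'x set set)" by (rule algebra.axioms(1)[OF algebra_Pow])
  ultimately have "subadditive (Pow UNIV) outer"
    by (intro ring_of_sets.countably_subadditive_subadditive)
  then have "outer ((U \<inter> A) \<union> (- U \<inter> A)) \<le> outer (U \<inter> A) + outer (- U \<inter> A)"
    by (rule subadditiveD) auto
  moreover have "(U \<inter> A) \<union> (- U \<inter> A) = A" by blast
  ultimately show "outer A \<le> outer (U \<inter> A) + outer (- U \<inter> A)" by simp
qed

section \<open>The representing measure\<close>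

definition riesz_measure :: "'x measure" where
  "riesz_measure = measure_of UNIV (sets borel) outer"

lemma sets_riesz_measure: "sets riesz_measure = sets borel"
  unfolding riesz_measure_def
  by (metis sets.sets_measure_of_eq sets.sigma_sets_eq sets_measure_of space_borel sets.space_closed)

text \<open>\<open>measure_of\<close> returns the intended values only once \<open>outer\<close> is
  known to be countably additive on Borel sets. Caratheodory's theorem gives this on the
  sigma-algebra \<open>lambda_system\<close>, which contains the open sets and so all Borel
  sets.\<close>

lemma emeasure_riesz_measure:
  assumes "A \<in> sets borel" shows "emeasure riesz_measure A = outer A"
proof -
  interpret S: sigma_algebra UNIV "UNIV :: 'x set set" using sigma_algebra_Pow[of "UNIV::'x set"] by simp
  have ms: "measure_space UNIV (lambda_system UNIV UNIV outer) outer"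
    by (rule S.caratheodory_lemma[OF outer_space])
  then have sa: "sigma_algebra UNIV (lambda_system UNIV UNIV outer)" by (simp add: measure_space_def)
  have sub: "sets borel \<subseteq> lambda_system UNIV UNIV outer"
    unfolding borel_def using sigma_algebra.sigma_sets_subset[OF sa, of "{S. open S}"] open_in_lambda_system by auto
  have "positive (sets riesz_measure) outer" using ms by (simp add: measure_space_def positive_def)
  moreover have "countably_additive (sets riesz_measure) outer"
    using ms sub unfolding measure_space_def countably_additive_def sets_riesz_measure by blast
  ultimately show ?thesis
    using emeasure_measure_of[OF riesz_measure_def, of A] assms sets_riesz_measure by auto
qed

lemma prob_space_riesz_measure: "prob_space riesz_measure"
proof (rule prob_spaceI)
  have "open_content UNIV \<ge> ennreal (L (\<lambda>_. 1))" unfolding open_content_def by (intro SUP_upper) (auto simp: functions_below_def)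
  then have "open_content UNIV = 1" using open_content_le_1[of UNIV] one by simp
  moreover have "space riesz_measure = UNIV" by (simp add: riesz_measure_def space_measure_of_conv)
  ultimately show "emeasure riesz_measure (space riesz_measure) = 1"
    by (simp add: emeasure_riesz_measure outer_open)
qed

text \<open>With \<open>N = Suc n\<close>, the function \<open>N * f\<close> is cut into
  \<open>N\<close> horizontal layers. \<open>L\<close> of each layer is at most the integral of the
  layer beneath it; only the lowest layer is left over, at cost at most 1. Dividing by
  \<open>N\<close> leaves the error \<open>1 / N\<close>.\<close>

lemma L_le_integral:
  assumes cf: "continuous_on UNIV f" and f: "\<And>x. 0 \<le> f x" "\<And>x. f x \<le> 1"
  shows "L f \<le> (LINT x|riesz_measure. f x)"
proof -
  interpret prob_space riesz_measure by (rule prob_space_riesz_measure)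
  have int: "integrable riesz_measure g" if "continuous_on UNIV g" "\<And>x. 0 \<le> g x \<and> g x \<le> 1" for g :: "'x \<Rightarrow> real"
  proof (rule integrable_const_bound[where B=1])
    show "g \<in> borel_measurable riesz_measure"
      using borel_measurable_continuous_onI[OF that(1)] sets_riesz_measure measurable_cong_sets by blast
  qed (use that(2) in auto)
  have step: "L f \<le> (LINT x|riesz_measure. f x) + 1 / real (Suc n)" for n
  proof -
    define g where "g i x = max 0 (min 1 (real (Suc n) * f x - real i))" for i x
    have cg: "continuous_on UNIV (g i)" for i unfolding g_def by (intro continuous_intros cf)
    have g01: "0 \<le> g i x \<and> g i x \<le> 1" for i x by (simp add: g_def)
    have layers: "(\<Sum>i<k. g i x) = max 0 (min (real k) (real (Suc n) * f x))" for k x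
      by (induction k) (use f in \<open>auto simp: g_def\<close>)
    have f_eq: "real (Suc n) * f x = (\<Sum>i<Suc n. g i x)" for x
      unfolding layers using f[of x] mult_left_mono[OF f(2)[of x], of "real (Suc n)"] by (simp del: of_nat_Suc)
    \<comment> \<open>The measure of the open set \<open>U\<close> separates the two sides: layer
      \<open>i + 1\<close> lies below its indicator, while layer \<open>i\<close> equals 1 on
      it.\<close>
    have next_le: "L (g (Suc i)) \<le> (LINT x|riesz_measure. g i x)" for i
    proof -
      define U where "U = {x. real (Suc i) < real (Suc n) * f x}"
      have U: "open U" unfolding U_def by (intro open_Collect_less continuous_intros cf)
      have "g (Suc i) \<in> functions_below U" using cg[of "Suc i"] by (auto simp: functions_below_def g_def U_def indicator_def)
      then have "ennreal (L (g (Suc i))) \<le> open_content U" unfolding open_content_def by (rule SUP_upper)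
      also have "open_content U = emeasure riesz_measure U" using U by (simp add: emeasure_riesz_measure outer_open)
      finally have "L (g (Suc i)) \<le> prob U"
        by (simp add: emeasure_eq_measure)
      also have "prob U = (LINT x|riesz_measure. indicator U x)"
        using U sets_riesz_measure sets.sets_into_space[of U riesz_measure] by (simp add: Int_absorb2)
      also have "\<dots> \<le> (LINT x|riesz_measure. g i x)"
        by (intro integral_mono int[OF cg g01] integrable_real_indicator)
          (use U sets_riesz_measure in \<open>auto simp: emeasure_eq_measure indicator_def U_def g_def\<close>)
      finally show ?thesis .
    qed
    have "real (Suc n) * L f = L (\<lambda>x. real (Suc n) * f x)" using scale[OF cf] by simp
    also have "\<dots> = (\<Sum>i<Suc n. L (g i))" unfolding f_eq by (rule sum) (use cg in auto)
    also have "\<dots> = L (g 0) + (\<Sum>i<n. L (g (Suc i)))" by (rule sum.lessThan_Suc_shift)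
    also have "\<dots> \<le> 1 + (\<Sum>i<n. (LINT x|riesz_measure. g i x))"
      using mono[OF cg[of 0], of "\<lambda>_. 1"] g01 one by (intro add_mono sum_mono next_le) auto
    also have "(\<Sum>i<n. (LINT x|riesz_measure. g i x)) \<le> (\<Sum>i<Suc n. (LINT x|riesz_measure. g i x))"
      using g01 by (simp add: integral_nonneg_AE)
    also have "\<dots> = (LINT x|riesz_measure. (\<Sum>i<Suc n. g i x))" by (rule Bochner_Integration.integral_sum[symmetric]) (intro int cg g01)
    also have "\<dots> = real (Suc n) * (LINT x|riesz_measure. f x)" unfolding f_eq[symmetric] by simp
    finally show ?thesis by (simp add: field_simps del: of_nat_Suc)
  qed
  have "(\<lambda>n. (LINT x|riesz_measure. f x) + 1 / real (Suc n)) \<longlonglongrightarrow> (LINT x|riesz_measure. f x) + 0"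
    by (intro tendsto_intros LIMSEQ_Suc[OF lim_1_over_n])
  then show ?thesis using step LIMSEQ_le_const by force
qed

text \<open>For values in [0,1], applying \<open>L_le_integral\<close> to \<open>g\<close> and to
  \<open>1 - g\<close> gives both inequalities. A general continuous \<open>f\<close> is bounded by
  compactness and is an affine image of such a \<open>g\<close>.\<close>

theorem integral_riesz_measure:
  assumes cf: "continuous_on UNIV f"
  shows "(LINT x|riesz_measure. f x) = L f"
proof -
  interpret prob_space riesz_measure by (rule prob_space_riesz_measure)
  have unit: "(LINT x|riesz_measure. g x) = L g" if cg: "continuous_on UNIV g" and g: "\<And>x. 0 \<le> g x" "\<And>x. g x \<le> 1" for g
  proof -
    have int: "integrable riesz_measure g"
    proof (rule integrable_const_bound[where B=1])
      show "g \<in> borel_measurable riesz_measure"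
        using borel_measurable_continuous_onI[OF cg] sets_riesz_measure measurable_cong_sets by blast
    qed (use g in auto)
    have "L (\<lambda>x. 1 + (-1) * g x) \<le> (LINT x|riesz_measure. 1 + (-1) * g x)"
      by (rule L_le_integral) (use g in \<open>auto intro!: continuous_intros cg\<close>)
    also have "\<dots> = 1 - (LINT x|riesz_measure. g x)" using int by (simp add: prob_space)
    also have "L (\<lambda>x. 1 + (-1) * g x) = 1 + (-1) * L g"
      by (subst add) (intro continuous_intros cg | subst scale | simp add: one)+
    finally show ?thesis using L_le_integral[OF cg g] by simp
  qed
  have "compact (range f)" by (rule compact_continuous_image[OF cf compact])
  then obtain B where B: "\<And>x. \<bar>f x\<bar> \<le> B" by (metis compact_imp_bounded bounded_iff rangeI real_norm_def)
  \<comment> \<open>Adding 1 keeps the scaling constant positive even if \<open>f\<close> is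
    identically zero.\<close>
  define C where "C = B + 1"
  have "0 \<le> B" by (rule order_trans[OF abs_ge_zero B])
  then have C: "C > 0" "\<bar>f x\<bar> \<le> C" for x using B[of x] by (simp_all add: C_def)
  define g where "g x = 1/2 + 1/(2*C) * f x" for x
  have cg: "continuous_on UNIV g" unfolding g_def by (intro continuous_intros cf)
  have g01: "0 \<le> g x" "g x \<le> 1" for x using C(1) C(2)[of x] by (auto simp: g_def field_simps abs_le_iff)
  have f_eq: "f = (\<lambda>x. - C + 2*C * g x)" using C by (auto simp: g_def field_simps)
  have int: "integrable riesz_measure g"
  proof (rule integrable_const_bound[where B=1])
    show "g \<in> borel_measurable riesz_measure"
      using borel_measurable_continuous_onI[OF cg] sets_riesz_measure measurable_cong_sets by blast
  qed (use g01 in auto)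
  have "(LINT x|riesz_measure. f x) = - C + 2*C * (LINT x|riesz_measure. g x)"
    unfolding f_eq using int by (simp add: prob_space)
  also have "\<dots> = - C + 2*C * L g" by (simp add: unit cg g01)
  also have "\<dots> = L f" unfolding f_eq
    by (subst add) (intro continuous_intros cg | subst scale | simp add: const)+
  finally show ?thesis .
qed

end

section \<open>Means over sets and cluster points of functionals\<close>

lemma norm_set_integral_le:
  fixes \<phi> :: "'a \<Rightarrow> 'b::{banach, second_countable_topology}"
  assumes "A \<in> sets M" "emeasure M A < \<infinity>" "set_integrable M A \<phi>" "\<And>x. x \<in> A \<Longrightarrow> norm (\<phi> x) \<le> e"
  shows "norm (LINT x:A|M. \<phi> x) \<le> e * measure M A"
proof -
  have "norm (LINT x:A|M. \<phi> x) \<le> (LINT x|M. norm (indicator A x *\<^sub>R \<phi> x))"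
    unfolding set_lebesgue_integral_def by (rule integral_norm_bound)
  also have "\<dots> \<le> (LINT x|M. e * indicator A x)"
  proof (rule integral_mono)
    show "integrable M (\<lambda>x. norm (indicator A x *\<^sub>R \<phi> x))"
      using assms(3) unfolding set_integrable_def by (rule integrable_norm)
    show "integrable M (\<lambda>x. e * indicator A x)"
      using assms(1,2) by (intro integrable_mult_right integrable_real_indicator)
    show "norm (indicator A x *\<^sub>R \<phi> x) \<le> e * indicator A x" for x
      using assms(4)[of x] by (simp add: indicator_def)
  qed
  also have "\<dots> = e * measure M A" using assms sets.sets_into_space[OF assms(1)] by (simp add: Int_absorb2)
  finally show ?thesis .
qed

text \<open>\<open>Avg\<close> and \<open>set_average\<close> are both of this shape, for real as
  well as complex values, so estimates for means are proved once.\<close>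

definition set_mean :: "'a measure \<Rightarrow> 'a set \<Rightarrow> ('a \<Rightarrow> 'b) \<Rightarrow> 'b::{banach, second_countable_topology}" where
  "set_mean M A \<phi> = (1 / measure M A) *\<^sub>R (LINT x:A|M. \<phi> x)"

text \<open>\<open>measure\<close> assigns the default value 0 to sets of infinite measure.\<close>

lemma emeasure_finite_of_measure_pos: "measure M A > 0 \<Longrightarrow> emeasure M A < \<infinity>"
  by (cases "emeasure M A = \<infinity>") (auto simp: measure_def less_top)

lemma norm_set_mean_diff_le:
  assumes A: "A \<in> sets M" "measure M A > 0" and int: "set_integrable M A \<phi>" "set_integrable M A \<psi>"
    and le: "\<And>x. x \<in> A \<Longrightarrow> norm (\<phi> x - \<psi> x) \<le> e"
  shows "norm (set_mean M A \<phi> - set_mean M A \<psi>) \<le> e"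
proof -
  have "set_mean M A \<phi> - set_mean M A \<psi> = (1 / measure M A) *\<^sub>R (LINT x:A|M. \<phi> x - \<psi> x)"
    using int by (simp add: set_mean_def set_integral_diff(2) scaleR_diff_right)
  then have "norm (set_mean M A \<phi> - set_mean M A \<psi>) = norm (LINT x:A|M. \<phi> x - \<psi> x) / measure M A"
    using A by simp
  also have "\<dots> \<le> (e * measure M A) / measure M A"
    using norm_set_integral_le[OF A(1) emeasure_finite_of_measure_pos[OF A(2)] set_integral_diff(1)[OF int] le]
    by (intro divide_right_mono) auto
  also have "\<dots> = e" using A by simp
  finally show ?thesis .
qed

lemma set_integrable_const_finite:
  fixes c :: "'b::{banach, second_countable_topology}"
  shows "A \<in> sets M \<Longrightarrow> emeasure M A < \<infinity> \<Longrightarrow> set_integrable M A (\<lambda>_. c)"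
  unfolding set_integrable_def by (intro integrable_scaleR_left integrable_real_indicator)

lemma set_mean_const:
  fixes c :: "'b::{banach, second_countable_topology}"
  assumes "A \<in> sets M" "measure M A > 0"
  shows "set_mean M A (\<lambda>_. c) = c"
proof -
  have "(LINT x:A|M. c) = (LINT x|M. indicator A x) *\<^sub>R c"
    unfolding set_lebesgue_integral_def
    by (intro integral_scaleR_left integrable_real_indicator emeasure_finite_of_measure_pos assms)
  then show ?thesis
    using assms sets.sets_into_space[OF assms(1)] by (simp add: set_mean_def Int_absorb2)
qed

lemma norm_set_mean_minus_const_le:
  assumes "A \<in> sets M" "measure M A > 0" "set_integrable M A \<phi>" "\<And>x. x \<in> A \<Longrightarrow> norm (\<phi> x - c) \<le> e"
  shows "norm (set_mean M A \<phi> - c) \<le> e"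
proof -
  have "set_integrable M A (\<lambda>_. c)"
    by (intro set_integrable_const_finite emeasure_finite_of_measure_pos assms)
  from norm_set_mean_diff_le[OF assms(1-3) this assms(4)] show ?thesis
    using assms(1,2) by (simp add: set_mean_const)
qed

lemma set_mean_mono:
  fixes \<phi> \<psi> :: "'a \<Rightarrow> real"
  assumes "measure M A > 0" "set_integrable M A \<phi>" "set_integrable M A \<psi>" "\<And>x. x \<in> A \<Longrightarrow> \<phi> x \<le> \<psi> x"
  shows "set_mean M A \<phi> \<le> set_mean M A \<psi>"
  using set_integral_mono[OF assms(2,3)] assms(1,4) by (simp add: set_mean_def divide_right_mono)

lemma set_mean_of_real: "set_mean M A (\<lambda>x. complex_of_real (h x)) = complex_of_real (set_mean M A h)"
  by (simp add: set_mean_def set_integral_complex_of_real scaleR_conv_of_real)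

lemma Avg_eq_set_mean: "Avg m T K f x = set_mean m K (\<lambda>g. f (T g x))"
  by (simp add: Avg_def set_mean_def)

lemma set_average_eq_set_mean: "set_average \<mu> C h = set_mean \<mu> C h"
  by (simp add: set_average_def set_mean_def)

text \<open>By Tychonoff's theorem the product of the intervals \<open>{- B a..B a}\<close> is
  compact. Filters replace subsequences because a product over many coordinates need not be
  sequentially compact; a general \<open>H\<close> allows the indices to be confined to a chosen
  set.\<close>

lemma pointwise_cluster_point:
  fixes \<Phi> :: "'k \<Rightarrow> 'a \<Rightarrow> real"
  assumes bound: "\<And>k a. \<bar>\<Phi> k a\<bar> \<le> B a" and H: "H \<noteq> bot"
  shows "\<exists>G \<Lambda>. G \<noteq> bot \<and> G \<le> H \<and> (\<forall>a. ((\<lambda>k. \<Phi> k a) \<longlongrightarrow> \<Lambda> a) G)"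
proof -
  define P where "P = PiE UNIV (\<lambda>a. {- B a..B a})"
  have "compactin (product_topology (\<lambda>_. euclidean) UNIV) P"
    unfolding P_def by (simp add: compactin_PiE)
  then have cP: "compact P" by (simp add: euclidean_product_topology)
  have "\<Phi> k \<in> P" for k using bound[of k] by (auto simp: P_def abs_le_iff minus_le_iff)
  then have "eventually (\<lambda>\<phi>. \<phi> \<in> P) (filtermap \<Phi> H)" by (simp add: eventually_filtermap)
  moreover have "filtermap \<Phi> H \<noteq> bot" using H by (simp add: filtermap_bot_iff)
  ultimately obtain \<Lambda> where \<Lambda>: "inf (nhds \<Lambda>) (filtermap \<Phi> H) \<noteq> bot"
    using cP unfolding compact_filter by blast
  \<comment> \<open>\<open>G\<close> consists of those parts of \<open>H\<close> on which
    \<open>\<Phi> k\<close> is close to \<open>\<Lambda>\<close>. It is proper because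
    \<open>\<Lambda>\<close> is a cluster point of the image filter.\<close>
  define G where "G = inf (filtercomap \<Phi> (nhds \<Lambda>)) H"
  have "G \<noteq> bot"
  proof
    assume "G = bot"
    then have "eventually (\<lambda>_. False) G" by simp
    then obtain Q R where Q: "eventually Q (filtercomap \<Phi> (nhds \<Lambda>))" and R: "eventually R H" "\<And>k. Q k \<Longrightarrow> R k \<Longrightarrow> False"
      unfolding G_def eventually_inf by blast
    then obtain Q' where Q': "eventually Q' (nhds \<Lambda>)" "\<And>k. Q' (\<Phi> k) \<Longrightarrow> Q k"
      unfolding eventually_filtercomap by blast
    have "eventually (\<lambda>\<phi>. \<not> Q' \<phi>) (filtermap \<Phi> H)"
      unfolding eventually_filtermap using R(1) by eventually_elim (use Q' R in blast)
    with Q'(1) have "eventually (\<lambda>_. False) (inf (nhds \<Lambda>) (filtermap \<Phi> H))"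
      unfolding eventually_inf by blast
    with \<Lambda> show False by (simp add: eventually_False)
  qed
  moreover have "G \<le> H" by (simp add: G_def)
  moreover have "((\<lambda>k. \<Phi> k a) \<longlongrightarrow> \<Lambda> a) G" for a
  proof -
    have "filterlim \<Phi> (nhds \<Lambda>) G"
      unfolding G_def by (rule filterlim_mono[OF filterlim_filtercomap order_refl]) simp
    then show ?thesis
      by (rule continuous_on_tendsto_compose[OF continuous_on_product_coordinates _ UNIV_I]) simp
  qed
  ultimately show ?thesis by blast
qed

lemma set_mean_Re_Im:
  fixes \<phi> :: "'a \<Rightarrow> complex"
  assumes "set_integrable M A \<phi>"
  shows "Re (set_mean M A \<phi>) = set_mean M A (\<lambda>x. Re (\<phi> x))"
    and "Im (set_mean M A \<phi>) = set_mean M A (\<lambda>x. Im (\<phi> x))"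
  using integral_Re[OF assms[unfolded set_integrable_def]] integral_Im[OF assms[unfolded set_integrable_def]]
  by (simp_all add: set_mean_def set_lebesgue_integral_def)

section \<open>Points and small open sets\<close>

lemma closed_singleton_metrizable:
  assumes "metrizable_space (euclidean :: 'x::topological_space topology)"
  shows "closed {x :: 'x}"
  using Hausdorff_imp_t1_space[OF metrizable_imp_Hausdorff_space[OF assms]]
  by (simp add: t1_space_closedin_singleton)

lemma atomless_singleton_null:
  assumes "atomless \<mu>" "{x} \<in> sets \<mu>"
  shows "emeasure \<mu> {x} = 0"
proof (rule ccontr)
  assume "emeasure \<mu> {x} \<noteq> 0"
  moreover have "emeasure \<mu> B = 0 \<or> emeasure \<mu> ({x} - B) = 0" if "B \<subseteq> {x}" for B
    using that by (cases "B = {}") (auto simp: subset_singleton_iff)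
  ultimately show False using assms unfolding atomless_def by (auto simp: zero_less_iff_neq_zero)
qed

text \<open>Open neighbourhoods inside \<open>W\<close> shrink to a single point, which is null
  since there are no atoms; continuity from above makes their measures tend to 0.\<close>

lemma small_open_subset:
  fixes \<mu> :: "'x::topological_space measure"
  assumes metr: "metrizable_space (euclidean :: 'x topology)" and \<mu>: "finite_measure \<mu>" "sets \<mu> = sets borel"
    and "atomless \<mu>" and W: "open W" "W \<noteq> {}" and e: "e > 0"
  shows "\<exists>U. open U \<and> U \<noteq> {} \<and> U \<subseteq> W \<and> measure \<mu> U < e"
proof -
  interpret finite_measure \<mu> by fact
  obtain x where x: "x \<in> W" using W by blast
  have cl: "closed {x}" by (rule closed_singleton_metrizable[OF metr])
  \<comment> \<open>A continuous function vanishing only at \<open>x\<close> supplies the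
    neighbourhoods as its sublevel sets.\<close>
  obtain \<phi> :: "'x \<Rightarrow> real" where \<phi>: "continuous_on UNIV \<phi>" "\<And>y. 0 \<le> \<phi> y" "\<And>y. \<phi> y \<le> 1"
    "- {x} = {y. \<phi> y > 0}"
    using metrizable_open_eq_positive_set[OF metr open_Compl[OF cl]] by blast
  have \<phi>0: "\<phi> y = 0 \<longleftrightarrow> y = x" for y
  proof -
    have "y \<in> - {x} \<longleftrightarrow> \<phi> y > 0" unfolding \<phi>(4) by simp
    then show ?thesis using \<phi>(2)[of y] by auto
  qed
  define U where "U n = W \<inter> {y. \<phi> y < 1 / real (Suc n)}" for n
  have oU: "open (U n)" for n unfolding U_def by (intro open_Int W open_Collect_less \<phi> continuous_intros)
  have dec: "decseq U"
  proof (rule decseq_SucI)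
    fix n
    have "1 / real (Suc (Suc n)) \<le> 1 / real (Suc n)" by (simp add: frac_le)
    then show "U (Suc n) \<subseteq> U n" unfolding U_def by auto
  qed
  have "(\<Inter>n. U n) = {x}"
  proof (intro equalityI subsetI)
    fix y assume y: "y \<in> (\<Inter>n. U n)"
    have "\<phi> y \<le> 0"
    proof (rule ccontr)
      assume "\<not> \<phi> y \<le> 0"
      then obtain n where "inverse (real (Suc n)) < \<phi> y" using reals_Archimedean[of "\<phi> y"] by auto
      moreover have "\<phi> y < 1 / real (Suc n)" using y by (auto simp: U_def)
      ultimately show False by (simp add: inverse_eq_divide)
    qed
    then show "y \<in> {x}" using \<phi>0[of y] \<phi>(2)[of y] by simp
  next
    fix y assume "y \<in> {x}"
    then show "y \<in> (\<Inter>n. U n)" using x \<phi>0[of x] by (auto simp: U_def)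
  qed
  moreover have "(\<lambda>n. measure \<mu> (U n)) \<longlonglongrightarrow> measure \<mu> (\<Inter>n. U n)"
    using oU \<mu>(2) by (intro finite_Lim_measure_decseq dec) auto
  moreover have "measure \<mu> {x} = 0"
    using atomless_singleton_null[OF assms(4), of x] cl \<mu>(2) by (simp add: measure_def)
  ultimately have "(\<lambda>n. measure \<mu> (U n)) \<longlonglongrightarrow> 0" by simp
  then have "\<forall>\<^sub>F n in sequentially. measure \<mu> (U n) < e" using order_tendstoD(2) e by blast
  then obtain n where "measure \<mu> (U n) < e" by (auto simp: eventually_sequentially)
  moreover have "x \<in> U n" using x \<phi>0[of x] by (simp add: U_def)
  ultimately show ?thesis using oU[of n] by (intro exI[of _ "U n"]) (auto simp: U_def)
qed

section \<open>Averages along orbits\<close>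

locale compact_group_action =
  fixes m :: "'g::{topological_group_add, t2_space} measure"
    and T :: "'g \<Rightarrow> 'x::topological_space \<Rightarrow> 'x"
  assumes haar: "left_haar_measure m"
    and compact_UNIV: "compact (UNIV :: 'x set)"
    and metrizable: "metrizable_space (euclidean :: 'x topology)"
    and action: "continuous_action T"
begin

lemma sets_haar: "sets m = sets borel"
  using haar by (simp add: left_haar_measure_def)

lemma space_haar: "space m = UNIV"
  using sets_eq_imp_space_eq[OF sets_haar] by simp

lemma compact_in_sets: "compact K \<Longrightarrow> K \<in> sets m"
  by (simp add: sets_haar borel_compact)

lemma compact_finite: "compact K \<Longrightarrow> emeasure m K < \<infinity>"
  using haar by (simp add: left_haar_measure_def)

lemma continuous_on_compose_action:
  fixes f :: "'x \<Rightarrow> 'b::topological_space"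
  assumes "continuous_on UNIV f"
  shows "continuous_on UNIV (\<lambda>(g, x). f (T g x))"
    and "continuous_on UNIV (\<lambda>g. f (T g x))"
    and "continuous_on UNIV (\<lambda>x. f (T g x))"
proof -
  have "continuous_on UNIV (\<lambda>(g, x). T g x)" using action by (simp add: continuous_action_def)
  from continuous_on_compose2[OF assms this] show *: "continuous_on UNIV (\<lambda>(g, x). f (T g x))"
    by (simp add: case_prod_beta)
  show "continuous_on UNIV (\<lambda>g. f (T g x))"
    using continuous_on_compose2[OF *, of UNIV "\<lambda>g. (g, x)"] by (simp add: continuous_intros)
  show "continuous_on UNIV (\<lambda>x. f (T g x))"
    using continuous_on_compose2[OF *, of UNIV "\<lambda>x. (g, x)"] by (simp add: continuous_intros)
qed

lemma continuous_bounded: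
  fixes f :: "'x \<Rightarrow> 'b::real_normed_vector"
  assumes "continuous_on UNIV f"
  shows "\<exists>B. \<forall>x. norm (f x) \<le> B"
  using compact_imp_bounded[OF compact_continuous_image[OF assms compact_UNIV]]
  unfolding bounded_iff by auto

lemma set_integrable_orbit:
  fixes f :: "'x \<Rightarrow> 'b::{banach, second_countable_topology}"
  assumes f: "continuous_on UNIV f" and A: "A \<in> sets m" "emeasure m A < \<infinity>"
  shows "set_integrable m A (\<lambda>g. f (T g x))"
proof -
  obtain B where B: "\<And>x. norm (f x) \<le> B" using continuous_bounded[OF f] by blast
  have "(\<lambda>g. f (T g x)) \<in> borel_measurable m"
    using borel_measurable_continuous_onI[OF continuous_on_compose_action(2)[OF f]] sets_haar measurable_cong_sets by blast
  then show ?thesis unfolding set_integrable_def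
    by (rule integrableI_bounded_set_indicator[OF A(1) _ A(2), of _ B]) (use B in auto)
qed

lemma integrable_continuous:
  fixes f :: "'x \<Rightarrow> 'b::{banach, second_countable_topology}"
  assumes "continuous_on UNIV f" "finite_measure \<nu>" "sets \<nu> = sets borel"
  shows "integrable \<nu> f"
proof -
  interpret finite_measure \<nu> by fact
  obtain B where B: "\<And>x. norm (f x) \<le> B" using continuous_bounded[OF assms(1)] by blast
  show ?thesis
  proof (rule integrable_const_bound[where B=B])
    show "f \<in> borel_measurable \<nu>"
      using borel_measurable_continuous_onI[OF assms(1)] assms(3) measurable_cong_sets by blast
  qed (use B in auto)
qed

lemma continuous_on_orbit_integral:
  fixes f :: "'x \<Rightarrow> 'b::{banach, second_countable_topology}"
  assumes f: "continuous_on UNIV f" and A: "A \<in> sets m" "A \<subseteq> K" and K: "compact K"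
  shows "continuous_on UNIV (\<lambda>x. LINT g:A|m. f (T g x))"
proof -
  have fin: "emeasure m A < \<infinity>"
    using emeasure_mono[OF A(2) compact_in_sets[OF K]] compact_finite[OF K] by (rule le_less_trans)
  have "((\<lambda>x. LINT g:A|m. f (T g x)) \<longlongrightarrow> (LINT g:A|m. f (T g x0))) (at x0)" for x0
  proof (rule tendstoI)
    fix e :: real assume e: "e > 0"
    \<comment> \<open>The added 1 covers the case that \<open>A\<close> is null.\<close>
    define d where "d = e / (measure m A + 1)"
    have d: "d > 0" using e by (simp add: d_def add_nonneg_pos)
    define W where "W = {p. dist (f (T (snd p) (fst p))) (f (T (snd p) x0)) < d}"
    have "continuous_on UNIV (\<lambda>p::'x \<times> 'g. f (T (snd p) (fst p)))"
      using continuous_on_compose2[OF continuous_on_compose_action(1)[OF f], of UNIV "\<lambda>p. (snd p, fst p)"]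
      by (simp add: continuous_intros)
    moreover have "continuous_on UNIV (\<lambda>p::'x \<times> 'g. f (T (snd p) x0))"
      using continuous_on_compose2[OF continuous_on_compose_action(2)[OF f], of UNIV snd]
      by (simp add: continuous_intros)
    ultimately have "open W" unfolding W_def by (intro open_Collect_less continuous_intros)
    moreover have "{x0} \<times> K \<subseteq> W" using d by (auto simp: W_def)
    ultimately obtain X0 where X0: "x0 \<in> X0" "open X0" "X0 \<times> K \<subseteq> W" using Elementary_Topology.tube_lemma[OF K, of W x0] by blast
    have "dist (LINT g:A|m. f (T g x)) (LINT g:A|m. f (T g x0)) < e" if "x \<in> X0" for x
    proof -
      have "norm (f (T g x) - f (T g x0)) \<le> d" if "g \<in> A" for g
        using X0(3) \<open>x \<in> X0\<close> that A(2) by (auto simp: W_def dist_norm subset_iff intro: less_imp_le)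
      then have "norm (LINT g:A|m. f (T g x) - f (T g x0)) \<le> d * measure m A"
        by (intro norm_set_integral_le A fin set_integral_diff(1) set_integrable_orbit f)
      also have "\<dots> < d * (measure m A + 1)" using d by simp
      also have "\<dots> = e" using add_nonneg_pos[OF measure_nonneg zero_less_one, of m A] by (simp add: d_def)
      finally show ?thesis
        using set_integrable_orbit[OF f A(1) fin] by (simp add: dist_norm set_integral_diff(2))
    qed
    then show "\<forall>\<^sub>F x in at x0. dist (LINT g:A|m. f (T g x)) (LINT g:A|m. f (T g x0)) < e"
      unfolding eventually_at_topological using X0 by blast
  qed
  then show ?thesis by (simp add: continuous_on_def)
qed

lemma continuous_on_orbit_mean:
  fixes f :: "'x \<Rightarrow> 'b::{banach, second_countable_topology}"
  assumes "continuous_on UNIV f" "compact K"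
  shows "continuous_on UNIV (\<lambda>x. set_mean m K (\<lambda>g. f (T g x)))"
  unfolding set_mean_def
  by (intro continuous_on_scaleR continuous_on_const continuous_on_orbit_integral[OF assms(1) _ order_refl assms(2)]
      compact_in_sets assms)

lemma invariant_measureD:
  assumes "\<nu> \<in> invariant_measures T"
  shows "sets \<nu> = sets borel" "prob_space \<nu>" "finite_measure \<nu>" "distr \<nu> borel (T g) = \<nu>"
  using assms by (auto simp: invariant_measures_def prob_space.finite_measure)

lemma T_measurable: "sets \<nu> = sets borel \<Longrightarrow> T g \<in> measurable \<nu> borel"
  using borel_measurable_continuous_onI[OF continuous_on_compose_action(3)[OF continuous_on_id, of g]]
    measurable_cong_sets by blast

lemma integral_translate:
  fixes f :: "'x \<Rightarrow> 'b::{banach, second_countable_topology}"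
  assumes "continuous_on UNIV f" "sets \<nu> = sets borel"
  shows "(LINT x|distr \<nu> borel (T g). f x) = (LINT x|\<nu>. f (T g x))"
  by (intro integral_distr T_measurable assms borel_measurable_continuous_onI)

text \<open>Fubini's theorem is not applicable because the group need not be second countable. Instead,
  the map from \<open>g\<close> to \<open>f \<circ> T g\<close> is uniformly approximated by step functions on \<open>K\<close>.\<close>

lemma integral_orbit_mean:
  fixes f :: "'x \<Rightarrow> real"
  assumes \<nu>: "\<nu> \<in> invariant_measures T" and f: "continuous_on UNIV f" and K: "compact K" "measure m K > 0"
  shows "(LINT x|\<nu>. set_mean m K (\<lambda>g. f (T g x))) = (LINT x|\<nu>. f x)"
proof -
  note inv = invariant_measureD[OF \<nu>]
  interpret prob_space \<nu> by (rule inv)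
  define b where "b = (LINT x|\<nu>. f x)"
  define J where "J A x = (LINT g:A|m. f (T g x))" for A x
  have fin: "emeasure m A < \<infinity>" if "A \<in> sets m" "A \<subseteq> K" for A
    using emeasure_mono[OF that(2) compact_in_sets[OF K(1)]] compact_finite[OF K(1)] by (rule le_less_trans)
  have cJ: "continuous_on UNIV (J A)" if "A \<in> sets m" "A \<subseteq> K" for A
    unfolding J_def using continuous_on_orbit_integral[OF f that K(1)] .
  have iJ: "integrable \<nu> (J A)" if "A \<in> sets m" "A \<subseteq> K" for A
    by (rule integrable_continuous[OF cJ[OF that] inv(3,1)])
  have transl: "(LINT x|\<nu>. f (T g x)) = b" for g
    using integral_translate[OF f inv(1), of g] inv(4)[of g] by (simp add: b_def)
  have approx: "\<bar>(LINT x|\<nu>. J K x) - measure m K * b\<bar> \<le> e * measure m K" if e: "e > 0" for e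
  proof -
    \<comment> \<open>Here the tube lemma is used with the compact space as fibre: near
      \<open>h\<close>, the functions \<open>f \<circ> T g\<close> are uniformly close to
      \<open>f \<circ> T h\<close>.\<close>
    have "\<exists>V. open V \<and> h \<in> V \<and> (\<forall>g\<in>V. \<forall>x. \<bar>f (T g x) - f (T h x)\<bar> \<le> e)" for h
    proof -
      define W where "W = {p. \<bar>f (T (fst p) (snd p)) - f (T h (snd p))\<bar> < e}"
      have "continuous_on UNIV (\<lambda>p::'g \<times> 'x. f (T (fst p) (snd p)))"
        using continuous_on_compose_action(1)[OF f] by (simp add: case_prod_beta)
      moreover have "continuous_on UNIV (\<lambda>p::'g \<times> 'x. f (T h (snd p)))"
        using continuous_on_compose2[OF continuous_on_compose_action(3)[OF f], of UNIV snd]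
        by (simp add: continuous_intros)
      ultimately have "open W" unfolding W_def by (intro open_Collect_less continuous_intros)
      moreover have "{h} \<times> UNIV \<subseteq> W" using e by (auto simp: W_def)
      ultimately obtain V where "h \<in> V" "open V" "V \<times> UNIV \<subseteq> W" using Elementary_Topology.tube_lemma[OF compact_UNIV, of W h] by blast
      then show ?thesis by (intro exI[of _ V]) (auto simp: W_def subset_iff intro: less_imp_le)
    qed
    then obtain V where V: "\<And>h. open (V h)" "\<And>h. h \<in> V h" "\<And>h g x. g \<in> V h \<Longrightarrow> \<bar>f (T g x) - f (T h x)\<bar> \<le> e"
      by metis
    have "K \<subseteq> (\<Union>h\<in>UNIV. V h)" using V(2) by blast
    then obtain D where D: "finite D" "K \<subseteq> (\<Union>h\<in>D. V h)"
      using compactE_image[OF K(1), of UNIV V] V(1) by metis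
    \<comment> \<open>On a piece inside one \<open>V h\<close>, the orbit integral is uniformly
      close to \<open>measure m A * f (T h x)\<close>, whose \<open>\<nu>\<close>-integral is
      \<open>measure m A * b\<close> by invariance.\<close>
    have small: "\<bar>(LINT x|\<nu>. J A x) - measure m A * b\<bar> \<le> e * measure m A"
      if A: "A \<in> sets m" "A \<subseteq> K" "A \<subseteq> V h" for A h
    proof -
      have int: "integrable \<nu> (\<lambda>x. f (T h x))"
        by (rule integrable_continuous[OF continuous_on_compose_action(3)[OF f] inv(3,1)])
      have "\<bar>J A x - measure m A * f (T h x)\<bar> \<le> e * measure m A" for x
      proof -
        have "measure m A * f (T h x) = (LINT g:A|m. f (T h x))"
          using A(1) space_haar by (simp add: set_lebesgue_integral_def)
        then have "J A x - measure m A * f (T h x) = (LINT g:A|m. f (T g x) - f (T h x))"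
          unfolding J_def
          by (simp add: set_integral_diff(2)[OF set_integrable_orbit[OF f A(1) fin[OF A(1,2)]]
                set_integrable_const_finite[OF A(1) fin[OF A(1,2)]]])
        also have "norm \<dots> \<le> e * measure m A"
          by (intro norm_set_integral_le set_integral_diff(1) set_integrable_orbit f set_integrable_const_finite A fin)
            (use V(3) A(3) in auto)
        finally show ?thesis by simp
      qed
      then have "norm (LINT x|\<nu>. J A x - measure m A * f (T h x)) \<le> e * measure m A"
        using int iJ[OF A(1,2)] 
        by (intro order_trans[OF integral_norm_bound] integral_le_const) (auto intro!: integrable_norm)
      then show ?thesis using int iJ[OF A(1,2)] by (simp add: transl)
    qed
    \<comment> \<open>Induction on the cover, with \<open>A\<close> general: the part of
      \<open>A\<close> inside \<open>V h\<close> is handled by \<open>small\<close>, the remainder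
      is covered by the other sets, and the errors add up in proportion to the measure.\<close>
    have "\<bar>(LINT x|\<nu>. J A x) - measure m A * b\<bar> \<le> e * measure m A"
      if "finite D" "A \<in> sets m" "A \<subseteq> K" "A \<subseteq> (\<Union>h\<in>D. V h)" for A D
      using that
    proof (induction D arbitrary: A rule: finite_induct)
      case empty
      then have "A = {}" by simp
      then show ?case by (simp add: J_def set_lebesgue_integral_def)
    next
      case (insert h D)
      have "V h \<in> sets m" using V(1) by (simp add: sets_haar)
      define A1 A2 where "A1 = A \<inter> V h" and "A2 = A - V h"
      have A1: "A1 \<in> sets m" "A1 \<subseteq> K" "A1 \<subseteq> V h" and A2: "A2 \<in> sets m" "A2 \<subseteq> K" "A2 \<subseteq> (\<Union>h\<in>D. V h)"
        using insert.prems \<open>V h \<in> sets m\<close> by (auto simp: A1_def A2_def)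
      have un: "A = A1 \<union> A2" "A1 \<inter> A2 = {}" by (auto simp: A1_def A2_def)
      have "J A x = J A1 x + J A2 x" for x
        unfolding J_def un(1) using set_integrable_orbit[OF f] A1 A2 fin un(2) by (intro set_integral_Un) auto
      then have 1: "(LINT x|\<nu>. J A x) = (LINT x|\<nu>. J A1 x) + (LINT x|\<nu>. J A2 x)"
        using iJ[OF A1(1,2)] iJ[OF A2(1,2)] by simp
      have 2: "measure m A = measure m A1 + measure m A2"
        unfolding un(1) using fin[OF A1(1,2)] fin[OF A2(1,2)] A1 A2 un(2) by (intro measure_Union) (auto simp: less_top)
      show ?case using small[OF A1] insert.IH[OF A2] unfolding 1 2 by (simp add: abs_le_iff algebra_simps)
    qed
    from this[OF D(1) compact_in_sets[OF K(1)] order_refl D(2)] show ?thesis .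
  qed
  have "\<bar>(LINT x|\<nu>. J K x) - measure m K * b\<bar> \<le> 0"
  proof (rule field_le_epsilon)
    fix e :: real assume "e > 0"
    then show "\<bar>(LINT x|\<nu>. J K x) - measure m K * b\<bar> \<le> 0 + e"
      using approx[of "e / measure m K"] K(2) by simp
  qed
  then show ?thesis using K(2) by (simp add: set_mean_def b_def J_def[symmetric])
qed

text \<open>Left invariance of \<open>m\<close> moves the translation by \<open>h\<close> from the
  function to the set. The integrals over \<open>hK\<close> and \<open>K\<close> then differ only on
  the symmetric difference, where the integrand is bounded by \<open>B\<close>.\<close>

lemma orbit_mean_translate_diff_le:
  fixes f :: "'x \<Rightarrow> real"
  assumes f: "continuous_on UNIV f" and B: "\<And>x. norm (f x) \<le> B" and K: "compact K" "measure m K > 0"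
  shows "\<bar>set_mean m K (\<lambda>g. f (T h (T g x))) - set_mean m K (\<lambda>g. f (T g x))\<bar>
    \<le> B * (measure m (sym_diff ((\<lambda>g. h + g) ` K) K) / measure m K)"
proof -
  define \<phi> where "\<phi> g = f (T g x)" for g
  define hK where "hK = (\<lambda>g. h + g) ` K"
  have hK: "compact hK" unfolding hK_def by (intro compact_continuous_image continuous_intros K)
  have meas: "(\<lambda>g. h + g) \<in> measurable m borel"
    unfolding measurable_cong_sets[OF sets_haar refl]
    by (intro borel_measurable_continuous_onI continuous_intros)
  have \<phi>m: "\<phi> \<in> borel_measurable borel"
    unfolding \<phi>_def by (intro borel_measurable_continuous_onI continuous_on_compose_action(2) f)
  have "(LINT g:K|m. f (T h (T g x))) = (LINT g|m. indicator hK (h + g) *\<^sub>R \<phi> (h + g))"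
    unfolding set_lebesgue_integral_def
    using action by (intro Bochner_Integration.integral_cong) (auto simp: continuous_action_def \<phi>_def hK_def indicator_def)
  also have "\<dots> = (LINT g|distr m borel (\<lambda>g. h + g). indicator hK g *\<^sub>R \<phi> g)"
    using borel_compact[OF hK] by (intro integral_distr[symmetric] meas borel_measurable_scaleR \<phi>m borel_measurable_indicator)
  also have "\<dots> = (LINT g:hK|m. \<phi> g)" using haar by (simp add: left_haar_measure_def set_lebesgue_integral_def)
  finally have eq: "(LINT g:K|m. f (T h (T g x))) = (LINT g:hK|m. \<phi> g)" .
  have i1: "set_integrable m hK \<phi>" and i2: "set_integrable m K \<phi>"
    unfolding \<phi>_def by (intro set_integrable_orbit f compact_in_sets compact_finite hK K(1))+
  have sd: "sym_diff hK K \<in> sets m" "emeasure m (sym_diff hK K) < \<infinity>"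
  proof -
    show 1: "sym_diff hK K \<in> sets m" using compact_in_sets hK K(1) by auto
    have "emeasure m (sym_diff hK K) \<le> emeasure m (hK \<union> K)"
      using compact_in_sets hK K(1) by (intro emeasure_mono) auto
    also have "\<dots> < \<infinity>" by (intro compact_finite compact_Un hK K(1))
    finally show "emeasure m (sym_diff hK K) < \<infinity>" .
  qed
  have "\<bar>(LINT g:hK|m. \<phi> g) - (LINT g:K|m. \<phi> g)\<bar> = norm (LINT g|m. indicator hK g *\<^sub>R \<phi> g - indicator K g *\<^sub>R \<phi> g)"
    using i1 i2 by (simp add: set_lebesgue_integral_def set_integrable_def)
  also have "\<dots> \<le> (LINT g|m. norm (indicator hK g *\<^sub>R \<phi> g - indicator K g *\<^sub>R \<phi> g))"
    by (rule integral_norm_bound)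
  also have "\<dots> \<le> (LINT g|m. B * indicator (sym_diff hK K) g)"
  proof (rule integral_mono)
    show "integrable m (\<lambda>g. norm (indicator hK g *\<^sub>R \<phi> g - indicator K g *\<^sub>R \<phi> g))"
      using i1 i2 unfolding set_integrable_def by (intro integrable_norm Bochner_Integration.integrable_diff)
    show "integrable m (\<lambda>g. B * indicator (sym_diff hK K) g)"
      using sd by (intro integrable_mult_right integrable_real_indicator)
    show "norm (indicator hK g *\<^sub>R \<phi> g - indicator K g *\<^sub>R \<phi> g) \<le> B * indicator (sym_diff hK K) g" for g
      using B[of "T g x"] by (auto simp: \<phi>_def indicator_def)
  qed
  also have "\<dots> = B * measure m (sym_diff hK K)" using sd space_haar by simp
  finally have le: "\<bar>(LINT g:hK|m. \<phi> g) - (LINT g:K|m. \<phi> g)\<bar> \<le> B * measure m (sym_diff hK K)" .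
  have "\<bar>set_mean m K (\<lambda>g. f (T h (T g x))) - set_mean m K (\<lambda>g. f (T g x))\<bar> =
     \<bar>(LINT g:hK|m. \<phi> g) - (LINT g:K|m. \<phi> g)\<bar> / measure m K"
    using K(2) unfolding set_mean_def eq \<phi>_def by (simp add: abs_divide flip: diff_divide_distrib)
  also have "\<dots> \<le> B * measure m (sym_diff hK K) / measure m K" using le K(2) by (intro divide_right_mono) auto
  finally show ?thesis by (simp add: hK_def)
qed

section \<open>From unique ergodicity to convergence of averages\<close>

lemma uniform_convergence_orbit_means:
  fixes f :: "'x \<Rightarrow> real"
  assumes ue: "uniquely_ergodic T" and \<mu>: "\<mu> \<in> invariant_measures T" and F: "folner_sequence m F"
    and f: "continuous_on UNIV f" and e: "e > 0"
  shows "\<forall>\<^sub>F k in sequentially. \<forall>x. \<bar>set_mean m (F k) (\<lambda>g. f (T g x)) - (LINT x|\<mu>. f x)\<bar> < e"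
proof (rule ccontr)
  define c where "c = (LINT x|\<mu>. f x)"
  define bad where "bad k x \<longleftrightarrow> \<not> \<bar>set_mean m (F k) (\<lambda>g. f (T g x)) - c\<bar> < e" for k x
  define S where "S = {k. \<exists>x. bad k x}"
  assume "\<not> ?thesis"
  \<comment> \<open>Failure means that bad indices occur arbitrarily late, so restricting
    \<open>sequentially\<close> to \<open>S\<close> leaves a proper filter.\<close>
  then have H: "inf sequentially (principal S) \<noteq> bot"
    by (simp add: trivial_limit_def eventually_inf_principal S_def bad_def c_def)
  have Fk: "compact (F k)" "measure m (F k) > 0" "F k \<in> sets m" "emeasure m (F k) < \<infinity>" for k
    using F compact_in_sets compact_finite by (auto simp: folner_sequence_def)
  define x where "x k = (SOME x. bad k x)" for k
  have bad: "bad k (x k)" if "k \<in> S" for k using that unfolding S_def x_def by (auto intro: someI_ex)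
  define M where "M k f = set_mean m (F k) (\<lambda>g. f (T g (x k)))" for k and f :: "'x \<Rightarrow> real"
  \<comment> \<open>The compactness lemma asks for a bound at every function, so discontinuous ones
    get the default value 0.\<close>
  define \<Phi> where "\<Phi> k f = (if continuous_on UNIV f then M k f else 0)" for k f
  define bnd where "bnd f = (SOME B. \<forall>x. norm (f x) \<le> B)" for f :: "'x \<Rightarrow> real"
  have bnd: "norm (f x) \<le> bnd f" if "continuous_on UNIV f" for f x
    using continuous_bounded[OF that] someI_ex[of "\<lambda>B. \<forall>x. norm (f x) \<le> B"] unfolding bnd_def by metis
  have int: "set_integrable m (F k) (\<lambda>g. f (T g y))" if "continuous_on UNIV f" for f :: "'x \<Rightarrow> real" and k y
    by (rule set_integrable_orbit[OF that Fk(3,4)])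
  have \<Phi>_bound: "\<bar>\<Phi> k f\<bar> \<le> \<bar>bnd f\<bar>" for k f
  proof (cases "continuous_on UNIV f")
    case True
    have "norm (set_mean m (F k) (\<lambda>g. f (T g (x k))) - 0) \<le> \<bar>bnd f\<bar>"
      by (intro norm_set_mean_minus_const_le Fk int True) (use order_trans[OF bnd[OF True] abs_ge_self] in simp)
    then show ?thesis by (simp add: \<Phi>_def M_def)
  qed (simp add: \<Phi>_def)
  obtain G L where G: "G \<noteq> bot" "G \<le> inf sequentially (principal S)" and L: "\<forall>f. ((\<lambda>k. \<Phi> k f) \<longlongrightarrow> L f) G"
    using pointwise_cluster_point[of \<Phi> "\<lambda>f. \<bar>bnd f\<bar>", OF \<Phi>_bound H] by blast
  have M_lim: "((\<lambda>k. M k f) \<longlongrightarrow> L f) G" if "continuous_on UNIV f" for f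
    using L[rule_format, of f] that by (simp add: \<Phi>_def)
  have uniq: "L f = l" if "continuous_on UNIV f" "((\<lambda>k. M k f) \<longlongrightarrow> l) G" for f l
    using tendsto_unique[OF G(1) M_lim[OF that(1)] that(2)] .
  interpret R: positive_functional L
  proof
    show "compact (UNIV :: 'x set)" "metrizable_space (euclidean :: 'x topology)" by (rule compact_UNIV metrizable)+
    show "L (\<lambda>x. f x + g x) = L f + L g" if fg: "continuous_on UNIV f" "continuous_on UNIV g" for f g
    proof (rule uniq)
      have "M k (\<lambda>x. f x + g x) = M k f + M k g" for k
        using int[OF fg(1)] int[OF fg(2)] by (simp add: M_def set_mean_def set_integral_add(2) add_divide_distrib)
      then show "((\<lambda>k. M k (\<lambda>x. f x + g x)) \<longlongrightarrow> L f + L g) G" by (simp add: tendsto_add M_lim fg)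
    qed (intro continuous_intros fg)
    show "L (\<lambda>x. a * f x) = a * L f" if f: "continuous_on UNIV f" for f a
    proof (rule uniq)
      have "M k (\<lambda>x. a * f x) = a * M k f" for k by (simp add: M_def set_mean_def)
      then show "((\<lambda>k. M k (\<lambda>x. a * f x)) \<longlongrightarrow> a * L f) G" by (simp add: tendsto_mult_left M_lim f)
    qed (intro continuous_intros f)
    show "0 \<le> L f" if f: "continuous_on UNIV f" and f0: "\<And>x. 0 \<le> f x" for f
    proof (rule tendsto_lowerbound[OF M_lim[OF f] _ G(1)], rule always_eventually, rule allI)
      fix k
      have "set_mean m (F k) (\<lambda>_. 0) \<le> M k f" unfolding M_def
        by (intro set_mean_mono Fk int f set_integrable_const_finite f0)
      then show "0 \<le> M k f" using set_mean_const[OF Fk(3,2), of k "0::real"] by simp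
    qed
    show "L (\<lambda>_. 1) = 1"
      by (rule uniq) (simp_all add: M_def set_mean_const[OF Fk(3,2)])
  qed
  have G_seq: "G \<le> sequentially" using G(2) by simp
  \<comment> \<open>The Folner condition makes the translation error vanish along
    \<open>sequentially\<close>, hence along the finer filter \<open>G\<close>.\<close>
  have L_inv: "L (\<lambda>x. f (T h x)) = L f" if f: "continuous_on UNIV f" for f h
  proof (rule uniq)
    show c: "continuous_on UNIV (\<lambda>x. f (T h x))" by (rule continuous_on_compose_action(3)[OF f])
    have "((\<lambda>k. bnd f * (measure m (sym_diff ((\<lambda>g. h + g) ` F k) (F k)) / measure m (F k))) \<longlongrightarrow> bnd f * 0) G"
      using F by (intro tendsto_mult_left tendsto_mono[OF G_seq]) (auto simp: folner_sequence_def)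
    then have lim: "((\<lambda>k. bnd f * (measure m (sym_diff ((\<lambda>g. h + g) ` F k) (F k)) / measure m (F k))) \<longlongrightarrow> 0) G"
      by simp
    have "norm (M k (\<lambda>x. f (T h x)) - M k f)
        \<le> bnd f * (measure m (sym_diff ((\<lambda>g. h + g) ` F k) (F k)) / measure m (F k))" for k
      using orbit_mean_translate_diff_le[OF f bnd[OF f] Fk(1,2)] unfolding M_def real_norm_def .
    then have "((\<lambda>k. M k (\<lambda>x. f (T h x)) - M k f) \<longlongrightarrow> 0) G"
      by (intro Lim_null_comparison[OF always_eventually lim] allI)
    from tendsto_add[OF this M_lim[OF f]] show "((\<lambda>k. M k (\<lambda>x. f (T h x))) \<longlongrightarrow> L f) G" by simp
  qed
  have "distr R.riesz_measure borel (T h) = R.riesz_measure" for h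
  proof (rule finite_borel_measure_eqI[OF metrizable])
    show "finite_measure (distr R.riesz_measure borel (T h))" "finite_measure R.riesz_measure"
      by (intro prob_space.finite_measure prob_space.prob_space_distr R.prob_space_riesz_measure
          T_measurable R.sets_riesz_measure)+
    show "(LINT x|distr R.riesz_measure borel (T h). f x) = (LINT x|R.riesz_measure. f x)"
      if "continuous_on UNIV f" for f :: "'x \<Rightarrow> real"
      using that by (simp add: integral_translate R.sets_riesz_measure R.integral_riesz_measure
          continuous_on_compose_action(3) L_inv)
  qed (simp_all add: R.sets_riesz_measure)
  then have "R.riesz_measure \<in> invariant_measures T"
    by (simp add: invariant_measures_def R.sets_riesz_measure R.prob_space_riesz_measure)
  then have "R.riesz_measure = \<mu>" using ue \<mu> unfolding uniquely_ergodic_def by blast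
  \<comment> \<open>Unique ergodicity forces the limit value \<open>c\<close>, while along
    \<open>G\<close> every index is bad, so \<open>M k f\<close> stays at distance at least
    \<open>e\<close> from \<open>c\<close>.\<close>
  then have "L f = c" using R.integral_riesz_measure[OF f] by (simp add: c_def)
  then have "\<forall>\<^sub>F k in G. dist (M k f) c < e" using tendstoD[OF M_lim[OF f] e] by simp
  moreover have "\<forall>\<^sub>F k in G. k \<in> S" using G(2) by (simp add: le_principal)
  ultimately have "\<forall>\<^sub>F k in G. False"
    by eventually_elim (use bad in \<open>auto simp: bad_def M_def dist_real_def\<close>)
  then show False using G(1) by simp
qed

text \<open>A bound on \<open>Avg\<close> that is uniform in \<open>x\<close> survives averaging
  over \<open>C k\<close>, however these sets vary with \<open>k\<close>.\<close>

lemma uniquely_ergodic_imp_averages_converge: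
  assumes ue: "uniquely_ergodic T" and \<mu>: "\<mu> \<in> invariant_measures T" and F: "folner_sequence m F"
  shows "averages_converge_to_mean m T \<mu> F (sets borel)"
  unfolding averages_converge_to_mean_def
proof (intro allI impI)
  fix C :: "nat \<Rightarrow> 'x set" and f :: "'x \<Rightarrow> complex"
  assume C: "\<forall>k. C k \<in> sets borel \<and> measure \<mu> (C k) > 0" and f: "continuous_on UNIV f"
  note inv = invariant_measureD[OF \<mu>]
  have Fk: "compact (F k)" "measure m (F k) > 0" "F k \<in> sets m" "emeasure m (F k) < \<infinity>" for k
    using F compact_in_sets compact_finite by (auto simp: folner_sequence_def)
  define c where "c = (LINT x|\<mu>. f x)"
  have int: "integrable \<mu> f" by (rule integrable_continuous[OF f inv(3,1)])
  have c: "Re c = (LINT x|\<mu>. Re (f x))" "Im c = (LINT x|\<mu>. Im (f x))"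
    using int by (simp_all add: c_def)
  have cont: "continuous_on UNIV (\<lambda>x. Re (f x))" "continuous_on UNIV (\<lambda>x. Im (f x))"
    by (intro continuous_intros f)+
  have "(\<lambda>k. set_average \<mu> (C k) (Avg m T (F k) f)) \<longlonglongrightarrow> c"
  proof (rule tendstoI)
    fix e :: real assume e: "e > 0"
    \<comment> \<open>Uniform convergence is known for real functions, so real and imaginary parts
      get \<open>e / 4\<close> each. The total \<open>e / 2\<close> leaves room for a strict
      inequality.\<close>
    have "\<forall>\<^sub>F k in sequentially. \<forall>x. \<bar>set_mean m (F k) (\<lambda>g. Re (f (T g x))) - Re c\<bar> < e / 4"
      "\<forall>\<^sub>F k in sequentially. \<forall>x. \<bar>set_mean m (F k) (\<lambda>g. Im (f (T g x))) - Im c\<bar> < e / 4"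
      unfolding c using e by (intro uniform_convergence_orbit_means[OF ue \<mu> F] cont; simp)+
    then show "\<forall>\<^sub>F k in sequentially. dist (set_average \<mu> (C k) (Avg m T (F k) f)) c < e"
    proof eventually_elim
      case (elim k)
      have "norm (Avg m T (F k) f x - c) \<le> e / 2" for x
      proof -
        have "\<bar>Re (Avg m T (F k) f x - c)\<bar> < e / 4" "\<bar>Im (Avg m T (F k) f x - c)\<bar> < e / 4"
          using elim set_mean_Re_Im[OF set_integrable_orbit[OF f Fk(3,4)]] by (simp_all add: Avg_eq_set_mean)
        then show ?thesis using cmod_le[of "Avg m T (F k) f x - c"] by linarith
      qed
      moreover have "continuous_on UNIV (Avg m T (F k) f)"
        unfolding Avg_eq_set_mean by (rule continuous_on_orbit_mean[OF f Fk(1)])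
      then have "integrable \<mu> (Avg m T (F k) f)" by (rule integrable_continuous[OF _ inv(3,1)])
      then have "set_integrable \<mu> (C k) (Avg m T (F k) f)"
        using C inv(1) unfolding set_integrable_def by (intro integrable_mult_indicator) auto
      ultimately have "norm (set_mean \<mu> (C k) (Avg m T (F k) f) - c) \<le> e / 2"
        using C inv(1) by (intro norm_set_mean_minus_const_le) auto
      then show ?case using e by (simp add: set_average_eq_set_mean dist_norm)
    qed
  qed
  then show "(\<lambda>k. set_average \<mu> (C k) (Avg m T (F k) f)) \<longlonglongrightarrow> (LINT x|\<mu>. f x)" by (simp add: c_def)
qed

section \<open>From two invariant measures to divergence\<close>

text \<open>The orbit mean has the same \<open>\<nu>\<close>-integral as \<open>f\<close>, so it
  cannot stay on the wrong side of \<open>b\<close> everywhere.\<close>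

lemma exists_orbit_mean_gt_and_less:
  fixes f :: "'x \<Rightarrow> real"
  assumes \<nu>: "\<nu> \<in> invariant_measures T" and f: "continuous_on UNIV f" and K: "compact K" "measure m K > 0"
  shows "b < (LINT x|\<nu>. f x) \<Longrightarrow> \<exists>x. b < set_mean m K (\<lambda>g. f (T g x))"
    and "(LINT x|\<nu>. f x) < b \<Longrightarrow> \<exists>x. set_mean m K (\<lambda>g. f (T g x)) < b"
proof -
  note inv = invariant_measureD[OF \<nu>]
  interpret prob_space \<nu> by (rule inv)
  have int: "integrable \<nu> (\<lambda>x. set_mean m K (\<lambda>g. f (T g x)))"
    by (rule integrable_continuous[OF continuous_on_orbit_mean[OF f K(1)] inv(3,1)])
  note eq = integral_orbit_mean[OF \<nu> f K]
  show "\<exists>x. b < set_mean m K (\<lambda>g. f (T g x))" if "b < (LINT x|\<nu>. f x)"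
  proof (rule ccontr)
    assume "\<not> ?thesis"
    then have "(LINT x|\<nu>. set_mean m K (\<lambda>g. f (T g x))) \<le> b" by (intro integral_le_const int) (auto simp: not_less)
    then show False using that eq by simp
  qed
  show "\<exists>x. set_mean m K (\<lambda>g. f (T g x)) < b" if "(LINT x|\<nu>. f x) < b"
  proof (rule ccontr)
    assume "\<not> ?thesis"
    then have "b \<le> (LINT x|\<nu>. set_mean m K (\<lambda>g. f (T g x)))" by (intro integral_ge_const int) (auto simp: not_less)
    then show False using that eq by simp
  qed
qed

text \<open>Divergence is claimed for all choices of \<open>U k\<close> inside \<open>W k\<close>,
  so that the lemma serves both the sets \<open>W k\<close> themselves and smaller sets of vanishing
  measure.\<close>

lemma not_uniquely_ergodic_oscillation:
  assumes nue: "\<not> uniquely_ergodic T" and \<mu>: "\<mu> \<in> invariant_measures T" and F: "folner_sequence m F"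
  shows "\<exists>(f :: 'x \<Rightarrow> complex) W. continuous_on UNIV f \<and> (\<forall>k. open (W k) \<and> W k \<noteq> {}) \<and>
    (\<forall>U. (\<forall>k. open (U k) \<and> U k \<subseteq> W k \<and> measure \<mu> (U k) > 0) \<longrightarrow>
       \<not> convergent (\<lambda>k. set_average \<mu> (U k) (Avg m T (F k) f)))"
proof -
  note inv = invariant_measureD[OF \<mu>]
  obtain \<nu> where \<nu>: "\<nu> \<in> invariant_measures T" "\<nu> \<noteq> \<mu>" using nue \<mu> unfolding uniquely_ergodic_def by blast
  obtain f :: "'x \<Rightarrow> real" where f: "continuous_on UNIV f" "(LINT x|\<nu>. f x) \<noteq> (LINT x|\<mu>. f x)"
    using finite_borel_measure_eqI[OF metrizable invariant_measureD(3)[OF \<nu>(1)] inv(3)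
      invariant_measureD(1)[OF \<nu>(1)] inv(1)] \<nu>(2) by blast
  \<comment> \<open>The measures \<open>\<mu>\<close> and \<open>\<nu>\<close> are renamed so that
    \<open>\<nu>1\<close> gives the smaller integral; \<open>a < b\<close> are then placed strictly
    between the two values.\<close>
  obtain \<nu>1 \<nu>2 where \<nu>12: "\<nu>1 \<in> invariant_measures T" "\<nu>2 \<in> invariant_measures T"
    "(LINT x|\<nu>1. f x) < (LINT x|\<nu>2. f x)" using f(2) \<nu>(1) \<mu> by (meson linorder_neqE_linordered_idom)
  then obtain a where a: "(LINT x|\<nu>1. f x) < a" "a < (LINT x|\<nu>2. f x)" using dense by blast
  then obtain b where b: "a < b" "b < (LINT x|\<nu>2. f x)" using dense by blast
  have Fk: "compact (F k)" "measure m (F k) > 0" for k using F by (auto simp: folner_sequence_def)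
  define A where "A k x = set_mean m (F k) (\<lambda>g. f (T g x))" for k x
  have cA: "continuous_on UNIV (A k)" for k unfolding A_def by (rule continuous_on_orbit_mean[OF f(1) Fk(1)])
  \<comment> \<open>Even indices use points where the mean exceeds \<open>b\<close>, with
    \<open>\<nu>2\<close> as witness of nonemptiness; odd indices use points where it is below
    \<open>a\<close>, with \<open>\<nu>1\<close>.\<close>
  define W where "W k = (if even k then {x. b < A k x} else {x. A k x < a})" for k
  have Avg: "Avg m T (F k) (\<lambda>x. complex_of_real (f x)) = (\<lambda>x. complex_of_real (A k x))" for k
    by (rule ext) (simp add: Avg_eq_set_mean set_mean_of_real A_def)
  show ?thesis
  proof (intro exI[of _ "\<lambda>x. complex_of_real (f x)"] exI[of _ W] conjI allI impI)
    show "continuous_on UNIV (\<lambda>x. complex_of_real (f x))" by (intro continuous_intros f)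
    show "open (W k)" for k
      unfolding W_def by (auto intro!: open_Collect_less cA continuous_intros)
    show "W k \<noteq> {}" for k
      using exists_orbit_mean_gt_and_less(1)[OF \<nu>12(2) f(1) Fk b(2), of k]
        exists_orbit_mean_gt_and_less(2)[OF \<nu>12(1) f(1) Fk a(1), of k]
      by (auto simp: W_def A_def)
    fix U :: "nat \<Rightarrow> 'x set"
    assume U: "\<forall>k. open (U k) \<and> U k \<subseteq> W k \<and> measure \<mu> (U k) > 0"
    define s where "s k = set_mean \<mu> (U k) (A k)" for k
    have Us: "U k \<in> sets \<mu>" for k using U inv(1) by simp
    have Ufin: "emeasure \<mu> (U k) < \<infinity>" for k using U by (intro emeasure_finite_of_measure_pos) blast
    have int: "set_integrable \<mu> (U k) (A k)" for k
      unfolding set_integrable_def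
      by (intro integrable_mult_indicator Us integrable_continuous[OF cA inv(3,1)])
    have even: "b \<le> s k" if "even k" for k
    proof -
      have "set_mean \<mu> (U k) (\<lambda>_. b) \<le> s k"
        unfolding s_def using U[rule_format, of k] that
        by (intro set_mean_mono int set_integrable_const_finite Us Ufin) (auto simp: W_def subset_iff intro: less_imp_le)
      then show ?thesis using U Us by (simp add: set_mean_const)
    qed
    have odd: "s k \<le> a" if "odd k" for k
    proof -
      have "s k \<le> set_mean \<mu> (U k) (\<lambda>_. a)"
        unfolding s_def using U[rule_format, of k] that
        by (intro set_mean_mono int set_integrable_const_finite Us Ufin) (auto simp: W_def subset_iff intro: less_imp_le)
      then show ?thesis using U Us by (simp add: set_mean_const)
    qed
    have eq: "set_average \<mu> (U k) (Avg m T (F k) (\<lambda>x. complex_of_real (f x))) = complex_of_real (s k)" for k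
      unfolding Avg by (simp add: set_average_eq_set_mean set_mean_of_real s_def)
    show "\<not> convergent (\<lambda>k. set_average \<mu> (U k) (Avg m T (F k) (\<lambda>x. complex_of_real (f x))))"
    proof
      assume "convergent (\<lambda>k. set_average \<mu> (U k) (Avg m T (F k) (\<lambda>x. complex_of_real (f x))))"
      then obtain l where "(\<lambda>k. complex_of_real (s k)) \<longlonglongrightarrow> l" unfolding eq convergent_def by blast
      from tendsto_Re[OF this] have l: "s \<longlonglongrightarrow> Re l" by simp
      \<comment> \<open>A limit would have real part at least \<open>b\<close> along even indices
        and at most \<open>a\<close> along odd ones.\<close>
      have "(\<lambda>k. s (2 * k)) \<longlonglongrightarrow> Re l" "(\<lambda>k. s (2 * k + 1)) \<longlonglongrightarrow> Re l"
        using LIMSEQ_subseq_LIMSEQ[OF l, of "\<lambda>k. 2 * k"] LIMSEQ_subseq_LIMSEQ[OF l, of "\<lambda>k. 2 * k + 1"]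
        by (simp_all add: strict_mono_def o_def)
      note lim = this
      have "b \<le> Re l" by (rule LIMSEQ_le_const[OF lim(1)]) (simp add: even)
      moreover have "Re l \<le> a" by (rule LIMSEQ_le_const2[OF lim(2)]) (simp add: odd)
      ultimately show False using b(1) by simp
    qed
  qed
qed

end

section \<open>The implications and the shrinking open sets\<close>

theorem theorem1p16:
  fixes m :: "'g::{topological_group_add, t2_space} measure"
    and T :: "'g \<Rightarrow> 'x::topological_space \<Rightarrow> 'x"
    and \<mu> :: "'x measure"
    and F :: "nat \<Rightarrow> 'g set"
  assumes "locally_compact_space (euclidean :: 'g topology)"
    and "bi_invariant_haar_measure m"
    and "amenable TYPE('g)"
    and "compact (UNIV :: 'x set)"
    and "metrizable_space (euclidean :: 'x topology)"
    and "continuous_action T"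
    and "\<mu> \<in> invariant_measures T"
    and "folner_sequence m F"
  shows "(uniquely_ergodic T \<longrightarrow> averages_converge_to_mean m T \<mu> F (sets borel)) \<and>
    (averages_converge_to_mean m T \<mu> F (sets borel) \<longrightarrow>
       averages_converge_to_mean m T \<mu> F (Collect open)) \<and>
    (averages_converge_to_mean m T \<mu> F (Collect open) \<longrightarrow>
       averages_converge m T \<mu> F (Collect open)) \<and>
    (fully_supported \<mu> \<longrightarrow>
       averages_converge m T \<mu> F (Collect open) \<longrightarrow> uniquely_ergodic T) \<and>
    (\<not> uniquely_ergodic T \<longrightarrow> fully_supported \<mu> \<longrightarrow> atomless \<mu> \<longrightarrow>
       (\<exists>(U :: nat \<Rightarrow> 'x set) (f :: 'x \<Rightarrow> complex).
          (\<forall>k. open (U k) \<and> measure \<mu> (U k) > 0) \<and>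
          continuous_on UNIV f \<and>
          \<not> convergent (\<lambda>k. set_average \<mu> (U k) (Avg m T (F k) f)) \<and>
          decseq (\<lambda>k. measure \<mu> (U k)) \<and>
          (\<lambda>k. measure \<mu> (U k)) \<longlonglongrightarrow> 0))"
proof (intro conjI impI)
  interpret compact_group_action m T
    using assms by unfold_locales (simp_all add: bi_invariant_haar_measure_def)
  note \<mu> = \<open>\<mu> \<in> invariant_measures T\<close> and F = \<open>folner_sequence m F\<close>
  note inv = invariant_measureD[OF \<mu>]
  define osc where "osc f W \<longleftrightarrow> continuous_on UNIV f \<and> (\<forall>k. open (W k) \<and> W k \<noteq> {}) \<and>
    (\<forall>U. (\<forall>k. open (U k) \<and> U k \<subseteq> W k \<and> measure \<mu> (U k) > 0) \<longrightarrow>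
       \<not> convergent (\<lambda>k. set_average \<mu> (U k) (Avg m T (F k) f)))" for f W
  have osc: "\<exists>f W. osc f W" if "\<not> uniquely_ergodic T"
    unfolding osc_def by (rule not_uniquely_ergodic_oscillation[OF that \<mu> F])
  show "averages_converge_to_mean m T \<mu> F (sets borel)" if "uniquely_ergodic T"
    by (rule uniquely_ergodic_imp_averages_converge[OF that \<mu> F])
  show "averages_converge_to_mean m T \<mu> F (Collect open)" if "averages_converge_to_mean m T \<mu> F (sets borel)"
    using that unfolding averages_converge_to_mean_def by (simp add: borel_open)
  show "averages_converge m T \<mu> F (Collect open)" if "averages_converge_to_mean m T \<mu> F (Collect open)"
    using that unfolding averages_converge_to_mean_def averages_converge_def convergent_def by blast
  show "uniquely_ergodic T" if full: "fully_supported \<mu>" and conv: "averages_converge m T \<mu> F (Collect open)"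
  proof (rule ccontr)
    assume "\<not> uniquely_ergodic T"
    then obtain f W where "osc f W" using osc by blast
    note fW = this[unfolded osc_def]
    \<comment> \<open>Full support turns nonempty open sets into sets of positive measure, so the
      oscillating sets \<open>W k\<close> themselves contradict convergence.\<close>
    have "open (W k) \<and> measure \<mu> (W k) > 0" for k using fW full by (simp add: fully_supported_def)
    moreover from this have "\<not> convergent (\<lambda>k. set_average \<mu> (W k) (Avg m T (F k) f))"
      using fW[THEN conjunct2, THEN conjunct2, rule_format, of W] by simp
    ultimately show False
      using conv[unfolded averages_converge_def, rule_format, of W f] fW by simp
  qed
  assume nue: "\<not> uniquely_ergodic T" and full: "fully_supported \<mu>" and "atomless \<mu>"
  obtain f W where "osc f W" using osc nue by blast
  note fW = this[unfolded osc_def]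
  define P where "P k U \<longleftrightarrow> open U \<and> U \<noteq> {} \<and> U \<subseteq> W k \<and> measure \<mu> U < 1 / real (Suc k)" for k U
  have W: "open (W k)" "W k \<noteq> {}" for k using fW by auto
  have small: "\<exists>U. open U \<and> U \<noteq> {} \<and> U \<subseteq> W k \<and> measure \<mu> U < e" if "e > 0" for k e
    by (rule small_open_subset[OF assms(5) inv(3,1) \<open>atomless \<mu>\<close> W that])
  have pos: "measure \<mu> U > 0" if "P k U" for k U using that full by (simp add: P_def fully_supported_def)
  \<comment> \<open>The sets are chosen successively, since monotonicity of the measures ties each
    choice to the previous one.\<close>
  have "\<exists>U. \<forall>k. P k (U k) \<and> measure \<mu> (U (Suc k)) \<le> measure \<mu> (U k)"
  proof (rule dependent_nat_choice)
    show "\<exists>U. P 0 U" using small[of 1 0] by (simp add: P_def)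
    show "\<exists>V. P (Suc k) V \<and> measure \<mu> V \<le> measure \<mu> U" if "P k U" for U k
      \<comment> \<open>Smaller than both the required bound and the measure of the previous set,
        which is positive by full support.\<close>
      using small[of "min (measure \<mu> U) (1 / real (Suc (Suc k)))" "Suc k"] pos[OF that]
      by (auto simp: P_def simp del: of_nat_Suc intro: less_imp_le)
  qed
  then obtain U where U: "\<And>k. P k (U k)" "\<And>k. measure \<mu> (U (Suc k)) \<le> measure \<mu> (U k)" by blast
  have Uk: "open (U k)" "U k \<subseteq> W k" "measure \<mu> (U k) \<le> 1 / real (Suc k)" "measure \<mu> (U k) > 0" for k
    using U(1)[of k] pos[OF U(1)] unfolding P_def by (simp_all only: less_imp_le)
  have "(\<lambda>k. measure \<mu> (U k)) \<longlonglongrightarrow> 0"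
  proof (rule tendsto_sandwich[OF _ _ tendsto_const LIMSEQ_Suc[OF lim_1_over_n]])
    show "\<forall>\<^sub>F k in sequentially. measure \<mu> (U k) \<le> 1 / real (Suc k)"
      by (intro always_eventually allI Uk)
  qed simp
  moreover have "decseq (\<lambda>k. measure \<mu> (U k))" by (intro decseq_SucI U)
  moreover have "\<not> convergent (\<lambda>k. set_average \<mu> (U k) (Avg m T (F k) f))"
    by (intro fW[THEN conjunct2, THEN conjunct2, rule_format] conjI Uk)
  ultimately show "\<exists>(U :: nat \<Rightarrow> 'x set) (f :: 'x \<Rightarrow> complex).
          (\<forall>k. open (U k) \<and> measure \<mu> (U k) > 0) \<and>
          continuous_on UNIV f \<and>
          \<not> convergent (\<lambda>k. set_average \<mu> (U k) (Avg m T (F k) f)) \<and>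
          decseq (\<lambda>k. measure \<mu> (U k)) \<and>
          (\<lambda>k. measure \<mu> (U k)) \<longlonglongrightarrow> 0"
    using fW[THEN conjunct1] Uk(1,4) by (intro exI[of _ U] exI[of _ f] conjI allI) simp_all
qed

end
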